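(* Let $\Bbbk$ be an algebraically closed field of characteristic $p>0$, let $L=\sum_{i=0}^nc_ix^i\partial^i$ ($c_i\in\Bbbk$, $c_n\neq0$) be an Euler operator of order $n$, and let $\Omega=\{\rho_1,\ldots,\rho_k\}$ be the set of local exponents of $L$ at $0$ with multiplicities $m_{\rho_1},\ldots,m_{\rho_k}$. The solutions of $Ly=0$ in $\mathcal{R}$ form a $\mathcal{C}$-subspace of dimension $n$. A basis is given by $$y_{\rho,i}:=t^\rho z^{i^*},\qquad\rho\in\Omega,\ 0\le i<m_\rho,$$ where $i^*=(i,\lfloor i/p\rfloor,\lfloor i/p^2\rfloor,\lfloor i/p^3\rfloor,\ldots)\in\mathbb{Z}^{(\mathbb{N})}$.
   Context: $z=(z_1,z_2,\ldots)$ are countably many variables; for a finitely supported integer sequence $\alpha=(\alpha_1,\alpha_2,\ldots)\in\mathbb{Z}^{(\mathbb{N})}$, $z^\alpha=\prod_iz_i^{\alpha_i}$. $\Bbbk(z)=\Bbbk(z_1,z_2,\ldots)$, $\Bbbk(z^p)=\Bbbk(z_1^p,z_2^p,\ldots)$, and $\mathbb{F}_p$ is the prime field of $\Bbbk$. The ring $\mathcal{R}=\bigoplus_{\rho\in\Bbbk}t^\rho\,\Bbbk(z)((x))$ is the group algebra of the additive group of $\Bbbk$ over $\Bbbk(z)((x))$, i.e. $(t^\rho f)(t^\sigma g)=t^{\rho+\sigma}fg$, $t^0=1$. Its derivation $\partial$ (extended termwise to Laurent series in $x$) is $\Bbbk$-linear with $\partial x=1$, $\partial t^\rho=\rho\,t^\rho\frac1x$,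 $\partial z_1=\frac1x$, $\partial z_k=\frac{1}{x\,z_1\cdots z_{k-1}}$ for $k\ge2$. Its field of constants is $\mathcal{C}=\bigoplus_{\sigma\in\mathbb{F}_p}t^\sigma x^{p-\sigma}\Bbbk(z^p)((x^p))$ (in exponents of $x$, $\sigma$ is represented in $\{0,\ldots,p-1\}$). The indicial polynomial of $L$ is $\chi_L(s)=\sum_{i=0}^nc_i\,s(s-1)\cdots(s-i+1)\in\Bbbk[s]$; its roots are the local exponents, with multiplicity $m_\rho$ the multiplicity of the root $\rho$. *)

theory Defs
  imports
    "HOL-Library.Poly_Mapping"
    "HOL-Computational_Algebra.Computational_Algebra"
    "HOL-Algebra.Embedded_Algebras"
    "HOL-Algebra.Algebraic_Closure_Type"
begin

text \<open>
  The field \<open>k(z)\<close> is the fraction field of the polynomial ring in countably many variables, and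
  the ring \<open>R\<close> is the group algebra of the additive group of \<open>k\<close> over \<open>k(z)((x))\<close>: its elements
  are finitely supported maps from exponents to Laurent series, multiplied by convolution.
  Variables are numbered from 0, so \<open>zvar j\<close> is the variable written \<open>z_{j+1}\<close> in the usual
  numbering from 1.
\<close>

type_synonym 'k zpoly = "(nat \<Rightarrow>\<^sub>0 nat) \<Rightarrow>\<^sub>0 'k"
type_synonym 'k zrat = "'k zpoly fract"
type_synonym 'k eulring = "'k \<Rightarrow>\<^sub>0 'k zrat fls"

definition zconst :: "'k::field \<Rightarrow> 'k zrat" where
  "zconst c = to_fract (Poly_Mapping.single 0 c)"

definition zvar :: "nat \<Rightarrow> 'k::field zrat" where
  "zvar j = to_fract (Poly_Mapping.single (Poly_Mapping.single j 1) 1)"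

text \<open>The monomial \<open>z^\<alpha>\<close>; meaningful only for \<open>\<alpha>\<close> of finite support.\<close>

definition zmonom :: "(nat \<Rightarrow> int) \<Rightarrow> 'k::field zrat" where
  "zmonom \<alpha> = (\<Prod>j | \<alpha> j \<noteq> 0. zvar j powi \<alpha> j)"

definition tpow :: "'k \<Rightarrow> 'k::field zrat fls \<Rightarrow> 'k eulring" where
  "tpow \<rho> f = Poly_Mapping.single \<rho> f"

definition Rx :: "'k::field eulring" where
  "Rx = tpow 0 fls_X"

definition Rconst :: "'k::field \<Rightarrow> 'k eulring" where
  "Rconst c = tpow 0 (fls_const (zconst c))"


subsection \<open>The derivation\<close>

text \<open>
  The derivation of \<open>R\<close> maps \<open>k(z)\<close> to \<open>x\<inverse>k(z)\<close>. We therefore first define \<open>zdiff = x\<partial>\<close> on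
  \<open>k(z)\<close>: it is determined by \<open>zdiff (zvar j) = 1 / (zvar 0 \<dots> zvar (j - 1))\<close>, extended to
  polynomials by the chain rule and to fractions by the quotient rule.
\<close>

definition zvar_diff :: "nat \<Rightarrow> 'k::field zrat" where
  "zvar_diff j = 1 / (\<Prod>i<j. zvar i)"

definition zdiff_poly :: "'k::field zpoly \<Rightarrow> 'k zrat" where
  "zdiff_poly P = (\<Sum>m\<in>Poly_Mapping.keys P. \<Sum>j\<in>Poly_Mapping.keys m.
     to_fract (Poly_Mapping.single (m - Poly_Mapping.single j 1) (of_nat (Poly_Mapping.lookup m j) * Poly_Mapping.lookup P m))
       * zvar_diff j)"

lemma zvar_nonzero [simp]: "zvar j \<noteq> (0 :: 'k::field zrat)"
proof -
  have "Poly_Mapping.single (Poly_Mapping.single j 1) (1::'k) \<noteq> 0"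
    by (metis lookup_single_eq lookup_zero zero_neq_one)
  then show ?thesis unfolding zvar_def by (simp only: to_fract_eq_0_iff not_False_eq_True)
qed

definition zlogd :: "(nat \<Rightarrow>\<^sub>0 nat) \<Rightarrow> 'k::field zrat" where
  "zlogd m = (\<Sum>j\<in>Poly_Mapping.keys m. of_nat (Poly_Mapping.lookup m j) * (zvar_diff j / zvar j))"

lemma to_fract_mult': "to_fract (x * y :: 'a::idom) = to_fract x * to_fract y"
  by (simp add: to_fract_def)

lemma to_fract_sum': "to_fract (sum f A :: 'a::idom) = (\<Sum>x\<in>A. to_fract (f x))"
  by (induction A rule: infinite_finite_induct) auto

lemma to_fract_single_of_nat:
  "to_fract (Poly_Mapping.single m (of_nat k * c) :: 'k::field zpoly)
     = of_nat k * to_fract (Poly_Mapping.single m c)"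
  by (induction k) (simp_all add: algebra_simps single_add)

lemma zdiff_poly_alt:
  "zdiff_poly P = (\<Sum>m\<in>Poly_Mapping.keys P. to_fract (Poly_Mapping.single m (Poly_Mapping.lookup P m)) * zlogd m)"
  for P :: "'k::field zpoly"
proof -
  have "to_fract (Poly_Mapping.single (m - Poly_Mapping.single j 1) (of_nat (Poly_Mapping.lookup m j) * c))
          * zvar_diff j
      = to_fract (Poly_Mapping.single m c) * (of_nat (Poly_Mapping.lookup m j) * (zvar_diff j / zvar j))"
    if "j \<in> Poly_Mapping.keys m" for m j and c :: 'k
  proof -
    have "m = (m - Poly_Mapping.single j 1) + Poly_Mapping.single j 1"
      using that
      by (intro poly_mapping_eqI)
        (auto simp: lookup_add lookup_minus lookup_single when_def in_keys_iff)
    then have "Poly_Mapping.single m c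
        = Poly_Mapping.single (m - Poly_Mapping.single j 1) c
          * Poly_Mapping.single (Poly_Mapping.single j 1) 1"
      by (simp add: mult_single)
    then have "to_fract (Poly_Mapping.single m c)
        = to_fract (Poly_Mapping.single (m - Poly_Mapping.single j 1) c) * zvar j"
      by (simp add: to_fract_mult' zvar_def)
    then show ?thesis by (simp add: to_fract_single_of_nat)
  qed
  then show ?thesis
    unfolding zdiff_poly_def zlogd_def sum_distrib_left by (intro sum.cong refl)
qed

lemma zdiff_poly_superset:
  assumes "finite A" "Poly_Mapping.keys P \<subseteq> A"
  shows "zdiff_poly P = (\<Sum>m\<in>A. to_fract (Poly_Mapping.single m (Poly_Mapping.lookup P m)) * zlogd m)"
  unfolding zdiff_poly_alt using assms
  by (intro sum.mono_neutral_left) (auto simp: in_keys_iff)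

lemma zdiff_poly_0 [simp]: "zdiff_poly 0 = 0"
  by (simp add: zdiff_poly_def)

lemma zdiff_poly_add: "zdiff_poly (P + Q) = zdiff_poly P + zdiff_poly Q"
proof -
  let ?A = "Poly_Mapping.keys P \<union> Poly_Mapping.keys Q"
  have "Poly_Mapping.keys (P + Q) \<subseteq> ?A" by (rule Poly_Mapping.keys_add)
  then show ?thesis
    by (simp add: zdiff_poly_superset[of ?A] lookup_add single_add algebra_simps sum.distrib)
qed

lemma zdiff_poly_sum: "zdiff_poly (sum f A) = (\<Sum>x\<in>A. zdiff_poly (f x))"
  by (induction A rule: infinite_finite_induct) (auto simp: zdiff_poly_add)

lemma zdiff_poly_single:
  "zdiff_poly (Poly_Mapping.single m c) = to_fract (Poly_Mapping.single m c) * zlogd m"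
  by (subst zdiff_poly_superset[of "{m}"]) auto

lemma zlogd_superset:
  assumes "finite A" "Poly_Mapping.keys m \<subseteq> A"
  shows "zlogd m = (\<Sum>j\<in>A. of_nat (Poly_Mapping.lookup m j) * (zvar_diff j / zvar j))"
  unfolding zlogd_def using assms
  by (intro sum.mono_neutral_left) (auto simp: in_keys_iff)

lemma zlogd_add: "zlogd (m + m') = (zlogd m + zlogd m' :: 'k::field zrat)"
proof -
  let ?A = "Poly_Mapping.keys m \<union> Poly_Mapping.keys m'"
  have "Poly_Mapping.keys (m + m') \<subseteq> ?A" by (rule Poly_Mapping.keys_add)
  then have "zlogd (m + m') = (\<Sum>j\<in>?A. of_nat (Poly_Mapping.lookup (m + m') j)
      * (zvar_diff j / zvar j) :: 'k zrat)"
    by (intro zlogd_superset) auto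
  also have "\<dots> = zlogd m + zlogd m'"
    unfolding lookup_add of_nat_add distrib_right sum.distrib
    by (subst (1 2) zlogd_superset[of ?A]) auto
  finally show ?thesis .
qed

lemma poly_mapping_expand: "P = (\<Sum>m\<in>Poly_Mapping.keys P. Poly_Mapping.single m (Poly_Mapping.lookup P m))"
  by (intro poly_mapping_eqI)
    (auto simp: lookup_sum lookup_single when_def in_keys_iff if_distrib cong: if_cong)

lemma zdiff_poly_mult:
  "zdiff_poly (P * Q) = zdiff_poly P * to_fract Q + to_fract P * zdiff_poly Q"
  for P Q :: "'k::field zpoly"
proof -
  let ?s = "\<lambda>P m. Poly_Mapping.single m (Poly_Mapping.lookup P m) :: 'k zpoly"
  have single: "zdiff_poly (?s P m * ?s Q m')
      = zdiff_poly (?s P m) * to_fract (?s Q m') + to_fract (?s P m) * zdiff_poly (?s Q m')" for m m'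
  proof -
    have "to_fract (Poly_Mapping.single (m + m') (c * d) :: 'k zpoly)
        = to_fract (Poly_Mapping.single m c) * to_fract (Poly_Mapping.single m' d)" for c d
      by (simp add: mult_single flip: to_fract_mult')
    then show ?thesis
      unfolding mult_single zdiff_poly_single zlogd_add by (simp add: algebra_simps)
  qed
  have "P * Q = (\<Sum>m\<in>Poly_Mapping.keys P. ?s P m) * (\<Sum>m'\<in>Poly_Mapping.keys Q. ?s Q m')"
    using poly_mapping_expand[of P] poly_mapping_expand[of Q] by simp
  also have "\<dots> = (\<Sum>m\<in>Poly_Mapping.keys P. \<Sum>m'\<in>Poly_Mapping.keys Q. ?s P m * ?s Q m')"
    by (simp add: sum_product)
  finally have "zdiff_poly (P * Q)
      = (\<Sum>m\<in>Poly_Mapping.keys P. \<Sum>m'\<in>Poly_Mapping.keys Q. zdiff_poly (?s P m) * to_fract (?s Q m')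
           + to_fract (?s P m) * zdiff_poly (?s Q m'))"
    by (simp add: zdiff_poly_sum single)
  also have "\<dots> = (\<Sum>m\<in>Poly_Mapping.keys P. zdiff_poly (?s P m)) * (\<Sum>m'\<in>Poly_Mapping.keys Q. to_fract (?s Q m'))
      + (\<Sum>m\<in>Poly_Mapping.keys P. to_fract (?s P m)) * (\<Sum>m'\<in>Poly_Mapping.keys Q. zdiff_poly (?s Q m'))"
    by (simp add: sum.distrib sum_product)
  also have "\<dots> = zdiff_poly P * to_fract Q + to_fract P * zdiff_poly Q"
    using poly_mapping_expand[of P] poly_mapping_expand[of Q]
    by (simp add: zdiff_poly_sum[symmetric] to_fract_sum'[symmetric])
  finally show ?thesis .
qed

definition zdiff :: "'k::field zrat \<Rightarrow> 'k zrat" where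
  "zdiff q = (THE d. \<exists>a b. b \<noteq> 0 \<and> q = Fract a b \<and>
     d = (zdiff_poly a * to_fract b - to_fract a * zdiff_poly b) / (to_fract b)\<^sup>2)"

lemma zdiff_Fract:
  fixes a b :: "'k::field zpoly"
  assumes "b \<noteq> 0"
  shows "zdiff (Fract a b)
     = (zdiff_poly a * to_fract b - to_fract a * zdiff_poly b) / (to_fract b)\<^sup>2"
proof -
  have wd: "(zdiff_poly a * to_fract b - to_fract a * zdiff_poly b) / (to_fract b)\<^sup>2
      = (zdiff_poly c * to_fract d - to_fract c * zdiff_poly d) / (to_fract d)\<^sup>2"
    if h: "d \<noteq> 0" "Fract a b = Fract c d" for c d
  proof -
    have nz: "to_fract b \<noteq> 0" "to_fract d \<noteq> 0" using assms h by simp_all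
    have ad: "a * d = c * b" using assms h by (simp add: eq_fract)
    have e: "to_fract a * to_fract d = to_fract c * to_fract b"
      by (simp add: ad flip: to_fract_mult')
    have "zdiff_poly (a * d) = zdiff_poly (c * b)" using ad by simp
    then have d: "zdiff_poly a * to_fract d + to_fract a * zdiff_poly d
        = zdiff_poly c * to_fract b + to_fract c * zdiff_poly b"
      by (simp add: zdiff_poly_mult)
    have "(A * B - a' * B') / B\<^sup>2 = (C * D - c' * D') / D\<^sup>2"
      if h: "A * D + a' * D' = C * B + c' * B'" "a' * D = c' * B" "B \<noteq> 0" "D \<noteq> 0"
      for A B C D a' c' B' D' :: "'k zrat"
    proof -
      have c': "c' = a' * D / B" using h by (simp add: field_simps)
      have A: "A = (C * B + c' * B' - a' * D') / D" using h by (simp add: field_simps)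
      show ?thesis unfolding A c' using h(3,4) by (simp add: field_simps power2_eq_square)
    qed
    from this[OF d e nz] show ?thesis .
  qed
  show ?thesis
    unfolding zdiff_def by (rule the_equality) (use assms wd in \<open>blast, metis wd\<close>)
qed

lemma zdiff_to_fract: "zdiff (to_fract a) = zdiff_poly a"
  using zdiff_Fract[of 1 a] zdiff_poly_single[of 0 "1::'a"]
  by (simp add: to_fract_def[symmetric] zlogd_def)

lemma zdiff_add: "zdiff (f + g) = zdiff f + zdiff g"
proof (cases f, cases g)
  fix a b c d :: "'a zpoly"
  assume h: "f = Fract a b" "b \<noteq> 0" "g = Fract c d" "d \<noteq> 0"
  have nz: "to_fract b \<noteq> 0" "to_fract d \<noteq> 0" using h by simp_all
  show ?thesis
    using h nz by (simp add: zdiff_Fract zdiff_poly_add zdiff_poly_mult to_fract_mult')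
      (simp add: field_simps power2_eq_square)
qed

lemma quotient_rule_mult:
  fixes A B C D A' B' C' D' :: "'a::field"
  assumes "B \<noteq> 0" "D \<noteq> 0"
  shows "((A' * C + A * C') * (B * D) - A * C * (B' * D + B * D')) / (B * D)\<^sup>2
     = (A' * B - A * B') / B\<^sup>2 * (C / D) + (A / B) * ((C' * D - C * D') / D\<^sup>2)"
  using assms by (simp add: field_simps power2_eq_square)

lemma zdiff_mult: "zdiff (f * g) = zdiff f * g + f * zdiff g"
proof (cases f, cases g)
  fix a b c d :: "'a zpoly"
  assume h: "f = Fract a b" "b \<noteq> 0" "g = Fract c d" "d \<noteq> 0"
  have nz: "to_fract b \<noteq> 0" "to_fract d \<noteq> 0" using h by simp_all
  have fg: "Fract a b = to_fract a / to_fract b" "Fract c d = to_fract c / to_fract d"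
    by (simp_all add: to_fract_def)
  have bd: "b * d \<noteq> 0" using h by simp
  have "zdiff (f * g) = zdiff (Fract (a * c) (b * d))" using h by simp
  also have "\<dots> = zdiff (Fract a b) * Fract c d + Fract a b * zdiff (Fract c d)"
    unfolding zdiff_Fract[OF h(2)] zdiff_Fract[OF h(4)]
      zdiff_Fract[OF bd]
    unfolding zdiff_poly_mult to_fract_mult' fg
    by (rule quotient_rule_mult[OF nz])
  finally show ?thesis using h by simp
qed

lemma zdiff_zconst: "zdiff (zconst c) = 0"
  by (simp add: zconst_def zdiff_to_fract zdiff_poly_single zlogd_def)

lemma zdiff_zvar: "zdiff (zvar j :: 'k::field zrat) = zvar_diff j"
proof -
  have "zlogd (Poly_Mapping.single j 1) = (zvar_diff j / zvar j :: 'k zrat)"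
    by (simp add: zlogd_def)
  then show ?thesis
    unfolding zvar_def[of j] zdiff_to_fract zdiff_poly_single by (simp flip: zvar_def One_nat_def)
qed

lemma zdiff_0 [simp]: "zdiff 0 = 0"
  using zdiff_to_fract[of 0] by simp

lemma zdiff_sum: "zdiff (sum f A) = (\<Sum>x\<in>A. zdiff (f x))"
  by (induction A rule: infinite_finite_induct) (auto simp: zdiff_add)

lift_definition fls_zdiff :: "'k::field zrat fls \<Rightarrow> 'k zrat fls" is "\<lambda>f n. zdiff (f n)"
  by (auto elim: eventually_mono)

text \<open>The derivation on \<open>k(z)((x))\<close>, extended termwise to series in \<open>x\<close>.\<close>

definition ldiff :: "'k::field zrat fls \<Rightarrow> 'k zrat fls" where
  "ldiff f = fls_deriv f + fls_X_inv * fls_zdiff f"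

lemma fls_zdiff_nth [simp]: "fls_nth (fls_zdiff f) n = zdiff (fls_nth f n)"
  by transfer simp

lemma ldiff_0 [simp]: "ldiff 0 = 0"
proof -
  have "fls_zdiff 0 = 0" by (intro fls_eqI) simp
  then show ?thesis by (simp add: ldiff_def)
qed

text \<open>The derivation on \<open>R\<close>: \<open>\<partial>(t^\<rho> f) = t^\<rho> (\<rho> x\<inverse> f + \<partial>f)\<close>.\<close>

lift_definition Rdiff :: "'k::field eulring \<Rightarrow> 'k eulring" is
  "\<lambda>r \<rho>. fls_const (zconst \<rho>) * fls_X_inv * r \<rho> + ldiff (r \<rho>)"
  by (erule finite_subset[rotated]) auto

lemma ldiff_add: "ldiff (f + g) = ldiff f + ldiff g"
proof -
  have "fls_zdiff (f + g) = fls_zdiff f + fls_zdiff g"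
    by (intro fls_eqI) (simp add: zdiff_add)
  then show ?thesis by (simp add: ldiff_def algebra_simps)
qed

lemma fls_times_nth_superset:
  fixes f g :: "'a::semiring_0 fls"
  assumes "a \<le> fls_subdegree f" "b \<le> fls_subdegree g"
  shows "fls_nth (f * g) n = (\<Sum>i=a..n - b. fls_nth f i * fls_nth g (n - i))"
  unfolding fls_times_nth(2) using assms
  by (intro sum.mono_neutral_left) (auto simp: not_le)

lemma ldiff_mult: "ldiff (f * g) = ldiff f * g + f * ldiff g"
proof -
  define a where "a = min (fls_subdegree f) (fls_subdegree (fls_zdiff f))"
  define b where "b = min (fls_subdegree g) (fls_subdegree (fls_zdiff g))"
  have "fls_zdiff (f * g) = fls_zdiff f * g + f * fls_zdiff g"
    by (intro fls_eqI)
      (simp add: fls_times_nth_superset[of a _ b] a_def b_def zdiff_sum zdiff_mult sum.distrib)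
  then show ?thesis by (simp add: ldiff_def algebra_simps)
qed

lemma ldiff_fls_const: "ldiff (fls_const f) = fls_X_inv * fls_const (zdiff f)"
proof -
  have "fls_zdiff (fls_const f) = fls_const (zdiff f)" by (intro fls_eqI) simp
  then show ?thesis by (simp add: ldiff_def)
qed

lemma zdiff_1 [simp]: "zdiff 1 = 0"
  using zdiff_zconst[of 1] by (simp add: zconst_def)

lemma ldiff_fls_X: "ldiff fls_X = 1"
proof -
  have "fls_zdiff fls_X = 0" by (intro fls_eqI) simp
  then show ?thesis by (simp add: ldiff_def)
qed

lemma ldiff_1 [simp]: "ldiff 1 = 0"
  using ldiff_fls_const[of 1] by simp

lemma zconst_0 [simp]: "zconst 0 = 0"
  by (simp add: zconst_def)

lemma zconst_add: "zconst (a + b) = zconst a + zconst b"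
  by (simp add: zconst_def single_add)

text \<open>
  The rules \<open>Rdiff_add\<close>, \<open>Rdiff_mult\<close>, \<open>Rdiff_Rconst\<close>, \<open>Rdiff_Rx\<close>, \<open>Rdiff_t\<close>, \<open>Rdiff_zvar\<close> below
  are the defining properties of the derivation.
\<close>

lemma Rdiff_tpow:
  "Rdiff (tpow \<rho> f) = tpow \<rho> (fls_const (zconst \<rho>) * fls_X_inv * f + ldiff f)"
  unfolding tpow_def by (intro poly_mapping_eqI) (simp add: Rdiff.rep_eq lookup_single when_def)

lemma Rdiff_add: "Rdiff (r + s) = Rdiff r + Rdiff s"
  by (intro poly_mapping_eqI) (simp add: Rdiff.rep_eq lookup_add ldiff_add algebra_simps)

lemma Rdiff_0 [simp]: "Rdiff 0 = 0"
  using Rdiff_add[of 0 0] by simp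

lemma Rdiff_sum: "Rdiff (sum f A) = (\<Sum>x\<in>A. Rdiff (f x))"
  by (induction A rule: infinite_finite_induct) (auto simp: Rdiff_add)

lemma tpow_mult: "tpow \<rho> f * tpow \<sigma> g = tpow (\<rho> + \<sigma>) (f * g)"
  by (simp add: tpow_def mult_single)

lemma tpow_add: "tpow \<rho> (f + g) = tpow \<rho> f + tpow \<rho> g"
  by (simp add: tpow_def single_add)

lemma tpow_0_1: "tpow 0 1 = 1"
  by (simp add: tpow_def)

lemma Rdiff_mult: "Rdiff (r * s) = Rdiff r * s + r * Rdiff s"
proof -
  let ?s = "\<lambda>r \<rho>. tpow \<rho> (Poly_Mapping.lookup r \<rho>)"
  have single: "Rdiff (tpow \<rho> f * tpow \<sigma> g)
      = Rdiff (tpow \<rho> f) * tpow \<sigma> g + tpow \<rho> f * Rdiff (tpow \<sigma> g)"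
    for \<rho> \<sigma> and f g :: "'a zrat fls"
    by (simp add: tpow_mult Rdiff_tpow zconst_add ldiff_mult algebra_simps
        flip: tpow_add fls_plus_const)
  have ex: "r = (\<Sum>\<rho>\<in>Poly_Mapping.keys r. ?s r \<rho>)" for r :: "'a eulring"
    unfolding tpow_def by (rule poly_mapping_expand)
  have "r * s = (\<Sum>\<rho>\<in>Poly_Mapping.keys r. ?s r \<rho>) * (\<Sum>\<sigma>\<in>Poly_Mapping.keys s. ?s s \<sigma>)"
    using ex[of r] ex[of s] by simp
  also have "\<dots> = (\<Sum>\<rho>\<in>Poly_Mapping.keys r. \<Sum>\<sigma>\<in>Poly_Mapping.keys s. ?s r \<rho> * ?s s \<sigma>)"
    by (simp add: sum_product)
  finally have "Rdiff (r * s) = (\<Sum>\<rho>\<in>Poly_Mapping.keys r. Rdiff (?s r \<rho>))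
        * (\<Sum>\<sigma>\<in>Poly_Mapping.keys s. ?s s \<sigma>)
      + (\<Sum>\<rho>\<in>Poly_Mapping.keys r. ?s r \<rho>) * (\<Sum>\<sigma>\<in>Poly_Mapping.keys s. Rdiff (?s s \<sigma>))"
    by (simp add: Rdiff_sum single sum.distrib sum_product)
  then show ?thesis
    using ex[of r] ex[of s] by (simp add: Rdiff_sum[symmetric])
qed

lemma Rdiff_Rconst: "Rdiff (Rconst c) = 0"
  by (simp add: Rconst_def Rdiff_tpow ldiff_fls_const zdiff_zconst) (simp add: tpow_def)

lemma Rdiff_Rx: "Rdiff Rx = 1"
  by (simp add: Rx_def Rdiff_tpow ldiff_fls_X tpow_0_1)

lemma Rdiff_t: "Rdiff (tpow \<rho> 1) = Rconst \<rho> * tpow \<rho> 1 * tpow 0 fls_X_inv"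
  by (simp add: Rconst_def Rdiff_tpow tpow_mult)

lemma Rdiff_zvar:
  "Rdiff (tpow 0 (fls_const (zvar j)))
     = tpow 0 (fls_X_inv * fls_const (1 / (\<Prod>i<j. zvar i)))"
  by (simp add: Rdiff_tpow ldiff_fls_const zdiff_zvar zvar_diff_def)


subsection \<open>The constants\<close>

text \<open>
  In the sequel \<open>p\<close> stands for the characteristic of \<open>k\<close>.
  The subrings \<open>k[z^p]\<close>, \<open>k(z^p)\<close> and \<open>k(z^p)((x^p))\<close>.\<close>

definition zpoly_pow :: "nat \<Rightarrow> 'k::field zpoly set" where
  "zpoly_pow p = {P. \<forall>m\<in>Poly_Mapping.keys P. \<forall>j. p dvd Poly_Mapping.lookup m j}"

definition zrat_pow :: "nat \<Rightarrow> 'k::field zrat set" where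
  "zrat_pow p = {Fract P Q |P Q. P \<in> zpoly_pow p \<and> Q \<in> zpoly_pow p \<and> Q \<noteq> 0}"

definition laurent_pow :: "nat \<Rightarrow> 'k::field zrat fls set" where
  "laurent_pow p = {f. \<forall>n. fls_nth f n \<in> zrat_pow p \<and> (fls_nth f n \<noteq> 0 \<longrightarrow> int p dvd n)}"

text \<open>
  \<open>\<Oplus>_\<sigma> t^\<sigma> x^(p-\<sigma>) k(z^p)((x^p))\<close>, where \<open>\<sigma>\<close> runs through the prime field, represented
  by \<open>0, \<dots>, p - 1\<close>.
\<close>

definition Rconstants :: "nat \<Rightarrow> 'k::field eulring set" where
  "Rconstants p = {\<Sum>\<sigma><p. tpow (of_nat \<sigma>) (fls_X ^ (p - \<sigma>) * g \<sigma>) |g. \<forall>\<sigma><p. g \<sigma> \<in> laurent_pow p}"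


subsection \<open>Euler operators\<close>

text \<open>
  The operator \<open>\<Sum>i\<le>n. c i x^i \<partial>^i\<close> is given by its coefficient sequence \<open>c\<close> and its order \<open>n\<close>;
  coefficients beyond \<open>n\<close> are ignored. Linear algebra over the subfield \<open>Rconstants p\<close> of \<open>R\<close> is
  that of HOL-Algebra, applied to \<open>ring_of_type_algebra\<close>, where \<open>subalgebra K V\<close> says that \<open>V\<close> is a
  \<open>K\<close>-subspace.
\<close>

definition euler_op :: "(nat \<Rightarrow> 'k::field) \<Rightarrow> nat \<Rightarrow> 'k eulring \<Rightarrow> 'k eulring" where
  "euler_op c n y = (\<Sum>i\<le>n. Rconst (c i) * Rx ^ i * (Rdiff ^^ i) y)"

definition euler_solutions :: "(nat \<Rightarrow> 'k::field) \<Rightarrow> nat \<Rightarrow> 'k eulring set" where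
  "euler_solutions c n = {y. euler_op c n y = 0}"

definition indicial_poly :: "(nat \<Rightarrow> 'k::field) \<Rightarrow> nat \<Rightarrow> 'k poly" where
  "indicial_poly c n = (\<Sum>i\<le>n. smult (c i) (\<Prod>j<i. [:- of_nat j, 1:]))"

definition local_exponents :: "(nat \<Rightarrow> 'k::field) \<Rightarrow> nat \<Rightarrow> 'k set" where
  "local_exponents c n = {\<rho>. poly (indicial_poly c n) \<rho> = 0}"

definition exponent_mult :: "(nat \<Rightarrow> 'k::field) \<Rightarrow> nat \<Rightarrow> 'k \<Rightarrow> nat" where
  "exponent_mult c n \<rho> = Polynomial.order \<rho> (indicial_poly c n)"

definition euler_index :: "(nat \<Rightarrow> 'k::field) \<Rightarrow> nat \<Rightarrow> ('k \<times> nat) set" where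
  "euler_index c n = {(\<rho>, i). \<rho> \<in> local_exponents c n \<and> i < exponent_mult c n \<rho>}"

text \<open>The exponent \<open>i* = (i, \<lfloor>i/p\<rfloor>, \<lfloor>i/p^2\<rfloor>, \<dots>)\<close>; its support is finite for \<open>p \<ge> 2\<close>.\<close>

definition istar :: "nat \<Rightarrow> nat \<Rightarrow> nat \<Rightarrow> int" where
  "istar p i = (\<lambda>j. int (i div p ^ j))"

lemma finite_istar_support: "p \<ge> 2 \<Longrightarrow> finite {j. istar p i j \<noteq> 0}"
proof -
  assume p: "p \<ge> 2"
  have "{j. istar p i j \<noteq> 0} \<subseteq> {..i}"
  proof
    fix j assume "j \<in> {j. istar p i j \<noteq> 0}"
    then have "p ^ j \<le> i" by (auto simp: istar_def div_eq_0_iff not_less)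
    moreover have "j < p ^ j" using p by (intro less_exp[THEN less_le_trans] power_mono) auto
    ultimately show "j \<in> {..i}" by simp
  qed
  then show ?thesis by (rule finite_subset) simp
qed

definition euler_basis :: "nat \<Rightarrow> 'k::field \<times> nat \<Rightarrow> 'k eulring" where
  "euler_basis p = (\<lambda>(\<rho>, i). tpow \<rho> (fls_const (zmonom (istar p i))))"

end

theory Submission
  imports Defs
begin

text \<open>
  On \<open>t^\<tau> x^m k(z)\<close> the operator \<open>x\<partial>\<close> acts as \<open>\<tau> + m + D\<close> with \<open>D = zdiff\<close>, so \<open>L y = 0\<close> says that every
  coefficient of \<open>y\<close> is killed by \<open>\<chi>(\<tau> + m + D)\<close>. The monomials \<open>z^{i*}\<close> span \<open>k(z)\<close> over \<open>k(z^p)\<close>, because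
  the exponents of \<open>z^{i*}\<close> reduced modulo \<open>p\<close> are the base \<open>p\<close> digits of \<open>i\<close>, and \<open>D z^{(i+1)*}\<close> is a
  nonzero scalar times \<open>z^{i*}\<close> plus a combination of lower \<open>z^{j*}\<close>. Hence \<open>D\<close> is locally nilpotent and
  the kernel of \<open>\<chi>(\<rho> + D)\<close>, which is that of \<open>D^m\<close> for \<open>m\<close> the multiplicity of \<open>\<rho>\<close>, has the basis
  \<open>z^{i*}\<close>, \<open>i < m\<close>. A constant is determined by its coefficients at \<open>t^{-m} x^m\<close>, so in a combination of the
  \<open>y_{\<rho>,i}\<close> only \<open>\<rho> = \<tau> + m\<close> contributes at \<open>t^\<tau> x^m\<close>, and coefficients can be compared one at a time.
\<close>


section \<open>Digits in base \<open>p\<close>\<close>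

lemma digit_sum_less:
  fixes p :: nat
  assumes "\<And>j. j < N \<Longrightarrow> d j < p"
  shows "(\<Sum>j<N. d j * p ^ j) < p ^ N"
  using assms
proof (induction N)
  case (Suc N)
  have "d N * p ^ N \<le> (p - 1) * p ^ N"
    using Suc.prems[of N] by (intro mult_right_mono) auto
  moreover have "p ^ Suc N = (p - 1) * p ^ N + p ^ N"
    using Suc.prems[of N] by (cases p) auto
  moreover have "(\<Sum>j<N. d j * p ^ j) < p ^ N" using Suc by simp
  ultimately show ?case unfolding sum.lessThan_Suc by linarith
qed simp

lemma digit_sum_digit:
  fixes p :: nat
  assumes "\<And>j. j < N \<Longrightarrow> d j < p" and "l < N"
  shows "(\<Sum>j<N. d j * p ^ j) div p ^ l mod p = d l"
  using assms
proof (induction N)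
  case (Suc N)
  have p: "p > 0" using Suc.prems(1)[of N] by auto
  show ?case
  proof (cases "l < N")
    case True
    then obtain r where r: "N = l + Suc r" using less_iff_Suc_add by auto
    have "(\<Sum>j<Suc N. d j * p ^ j) div p ^ l
        = ((\<Sum>j<N. d j * p ^ j) + (d N * p ^ Suc r) * p ^ l) div p ^ l"
      by (simp add: r power_add mult_ac)
    also have "\<dots> = d N * p ^ Suc r + (\<Sum>j<N. d j * p ^ j) div p ^ l"
      using p by (subst div_mult_self1) auto
    also have "\<dots> mod p = (\<Sum>j<N. d j * p ^ j) div p ^ l mod p"
      by (simp add: mult.left_commute)
    finally show ?thesis using Suc True by simp
  next
    case False
    then have l: "l = N" using Suc.prems by simp
    have "(\<Sum>j<N. d j * p ^ j) < p ^ N" by (rule digit_sum_less) (use Suc.prems in auto)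
    then show ?thesis using Suc.prems(1)[of N] p by (simp add: l)
  qed
qed simp

lemma digit_sum_mod:
  fixes p :: nat
  shows "(\<Sum>j<N. i div p ^ j mod p * p ^ j) = i mod p ^ N"
proof (induction N)
  case (Suc N)
  then show ?case
    using mod_mult2_eq[of i "p ^ N" p] by (simp add: mult.commute)
qed simp

text \<open>Lowering the digit at \<open>k\<close> by one loses \<open>p^k\<close>, and new digits
  below \<open>k\<close> regain less than that. The part of the old number below \<open>k\<close>
  remains as an additional gap; this second summand is what later pushes an index below
  \<open>m\<close> and not just below \<open>m + 1\<close>.\<close>

lemma digit_sum_decrease:
  fixes p :: nat
  assumes "k < N" "\<And>l. l < k \<Longrightarrow> b l < p" "d k = Suc (b k)"
    and "\<And>l. k < l \<Longrightarrow> l < N \<Longrightarrow> b l = d l"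
  shows "(\<Sum>l<N. b l * p ^ l) + (\<Sum>l<k. d l * p ^ l) < (\<Sum>l<N. d l * p ^ l)"
  using assms
proof (induction N)
  case (Suc N)
  show ?case
  proof (cases "k < N")
    case True
    then show ?thesis using Suc by simp
  next
    case False
    then have "k = N" using Suc.prems by simp
    moreover have "(\<Sum>l<k. b l * p ^ l) < p ^ k" by (rule digit_sum_less) (use Suc.prems in auto)
    ultimately show ?thesis using Suc.prems(3) by (simp add: algebra_simps)
  qed
qed simp


section \<open>The field \<open>k(z)\<close>\<close>

lemma zconst_1 [simp]: "zconst 1 = 1"
  by (simp add: zconst_def)

lemma zconst_mult: "zconst (a * b) = zconst a * zconst b"
  by (simp add: zconst_def mult_single flip: to_fract_mult')

lemma zconst_of_nat [simp]: "zconst (of_nat n) = of_nat n"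
  by (induction n) (simp_all add: zconst_add)

lemma zconst_eq_0_iff [simp]: "zconst c = 0 \<longleftrightarrow> c = 0"
  unfolding zconst_def to_fract_eq_0_iff by (metis lookup_single_eq single_zero)

lemma zconst_uminus: "zconst (- a) = - zconst a"
  using zconst_add[of a "- a"] by (simp add: eq_neg_iff_add_eq_0 add.commute)

lemma zdiff_zconst_mult: "zdiff (zconst c * f) = zconst c * zdiff f"
  by (simp add: zdiff_mult zdiff_zconst)

lemma zdiff_power: "zdiff (f ^ n) = of_nat n * f ^ (n - 1) * zdiff f"
proof (induction n)
  case (Suc n)
  then show ?case by (cases n) (simp_all add: zdiff_mult algebra_simps)
qed simp

lemma funpow_zdiff_add: "(zdiff ^^ m) (f + g) = (zdiff ^^ m) f + (zdiff ^^ m) g"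
  by (induction m) (simp_all add: zdiff_add)

lemma funpow_zdiff_0 [simp]: "(zdiff ^^ m) 0 = 0"
  by (induction m) simp_all

lemma funpow_zdiff_const_mult:
  "zdiff g = 0 \<Longrightarrow> (zdiff ^^ m) (g * f) = g * (zdiff ^^ m) f"
  by (induction m) (simp_all add: zdiff_mult)

lemma zmonom_eq_prod:
  assumes "\<And>j. j \<ge> N \<Longrightarrow> e j = 0"
  shows "zmonom e = (\<Prod>j<N. zvar j powi e j)"
  unfolding zmonom_def using assms
  by (intro prod.mono_neutral_left) (auto simp: not_le[symmetric])

lemma zlog_diff_prod:
  "zdiff (\<Prod>j<N. zvar j ^ a j) = (\<Sum>j<N. of_nat (a j) * (zvar_diff j / zvar j)) * (\<Prod>j<N. zvar j ^ a j)"
proof (induction N)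
  case (Suc N)
  have N: "zdiff (zvar N ^ a N) = of_nat (a N) * (zvar_diff N / zvar N) * zvar N ^ a N"
    unfolding zdiff_power zdiff_zvar by (cases "a N") simp_all
  show ?case unfolding prod.lessThan_Suc sum.lessThan_Suc zdiff_mult Suc N by (simp add: algebra_simps)
qed simp

lemma zvar_diff_div_zvar: "zvar_diff k / zvar k = (1 :: 'k::field zrat) / (\<Prod>j\<le>k. zvar j)"
  by (simp add: zvar_diff_def lessThan_Suc flip: lessThan_Suc_atMost)

lemma istar_eq_0: "i < p ^ N \<Longrightarrow> N \<le> j \<Longrightarrow> p > 0 \<Longrightarrow> istar p i j = 0"
  using power_increasing[of N j p] by (simp add: istar_def)

text \<open>In the \<open>k\<close>-th term, \<open>1 / (z_1 \<cdots> z_{k+1})\<close> lowers the first \<open>k + 1\<close> exponents by one.\<close>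

lemma zdiff_zmonom_istar:
  assumes "i < p ^ N" "p > 0"
  shows "zdiff (zmonom (istar p i) :: 'k::field zrat)
    = (\<Sum>k<N. of_nat (i div p ^ k) * zmonom (\<lambda>l. istar p i l - of_bool (l \<le> k)))"
proof -
  have mon: "zmonom (istar p i) = (\<Prod>j<N. zvar j ^ (i div p ^ j) :: 'k zrat)"
    by (subst zmonom_eq_prod[of N]) (use istar_eq_0[OF assms(1)] assms in \<open>auto simp: istar_def\<close>)
  have "zmonom (\<lambda>l. istar p i l - of_bool (l \<le> k)) = zmonom (istar p i) * (zvar_diff k / zvar k :: 'k zrat)"
    if "k < N" for k
  proof -
    have "zmonom (\<lambda>l. istar p i l - of_bool (l \<le> k))
        = (\<Prod>j<N. zvar j powi (istar p i j - of_bool (j \<le> k)) :: 'k zrat)"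
      by (rule zmonom_eq_prod) (use istar_eq_0[OF assms(1)] assms that in auto)
    also have "\<dots> = (\<Prod>j<N. zvar j ^ (i div p ^ j) / (if j \<le> k then zvar j else 1))"
      by (intro prod.cong) (auto simp: power_int_diff istar_def)
    also have "\<dots> = zmonom (istar p i) / (\<Prod>j<N. if j \<le> k then zvar j else 1)"
      by (simp add: mon prod_dividef)
    also have "(\<Prod>j<N. if j \<le> k then zvar j else 1) = (\<Prod>j\<le>k. zvar j :: 'k zrat)"
      using that by (subst prod.inter_filter[symmetric]) (auto intro!: prod.cong)
    finally show ?thesis by (simp add: zvar_diff_div_zvar)
  qed
  moreover have "zdiff (zmonom (istar p i))
      = (\<Sum>k<N. of_nat (i div p ^ k) * (zmonom (istar p i) * (zvar_diff k / zvar k)) :: 'k zrat)"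
    unfolding mon zlog_diff_prod sum_distrib_right by (intro sum.cong) simp_all
  ultimately show ?thesis by simp
qed


section \<open>The subfield \<open>k(z^p)\<close>\<close>

lemma CHAR_poly_mapping [simp]:
  "CHAR('a::{cancel_comm_monoid_add} \<Rightarrow>\<^sub>0 'b::comm_semiring_1) = CHAR('b)"
proof (rule CHAR_eqI)
  show "of_nat CHAR('b) = (0 :: 'a \<Rightarrow>\<^sub>0 'b)"
    by (metis of_nat_CHAR single_of_nat single_zero)
  show "CHAR('b) dvd n" if "of_nat n = (0 :: 'a \<Rightarrow>\<^sub>0 'b)" for n
    using that by (metis lookup_single_eq lookup_zero of_nat_eq_0_iff_char_dvd single_of_nat)
qed

lemma CHAR_fract [simp]: "CHAR('a::idom fract) = CHAR('a)"
proof (rule CHAR_eqI)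
  have of_nat: "of_nat n = to_fract (of_nat n :: 'a)" for n
    by (induction n) simp_all
  show "of_nat CHAR('a) = (0 :: 'a fract)"
    by (simp add: of_nat)
  show "CHAR('a) dvd n" if "of_nat n = (0 :: 'a fract)" for n
    using that by (simp add: of_nat of_nat_eq_0_iff_char_dvd)
qed

text \<open>For \<open>n = p\<close> all exponents of the power are divisible by \<open>p\<close>,
  so the \<open>p\<close>-th power of a term lies in \<open>k[z^p]\<close>.\<close>

lemma single_power:
  "\<exists>m'. Poly_Mapping.single m c ^ n = Poly_Mapping.single m' (c ^ n)
    \<and> (\<forall>j. Poly_Mapping.lookup m' j = n * Poly_Mapping.lookup m j)"
  for m :: "nat \<Rightarrow>\<^sub>0 nat" and c :: "'a::comm_semiring_1"
proof (induction n)
  case 0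
  show ?case by (rule exI[of _ 0]) simp
next
  case (Suc n)
  then obtain m' where "Poly_Mapping.single m c ^ n = Poly_Mapping.single m' (c ^ n)"
    "\<forall>j. Poly_Mapping.lookup m' j = n * Poly_Mapping.lookup m j" by blast
  then show ?case
    by (intro exI[of _ "m + m'"]) (simp add: mult_single lookup_add)
qed

section \<open>Closure properties of \<open>k[z^p]\<close> and \<open>k(z^p)\<close>\<close>

lemma zpoly_pow_0 [simp]: "0 \<in> zpoly_pow p"
  and zpoly_pow_single_0 [simp]: "Poly_Mapping.single 0 c \<in> zpoly_pow p"
  by (simp_all add: zpoly_pow_def)

lemma zpoly_pow_1 [simp]: "1 \<in> zpoly_pow p"
  using zpoly_pow_single_0[of 1] by simp

lemma zpoly_pow_add: "P \<in> zpoly_pow p \<Longrightarrow> Q \<in> zpoly_pow p \<Longrightarrow> P + Q \<in> zpoly_pow p"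
  using Poly_Mapping.keys_add[of P Q] unfolding zpoly_pow_def by blast

lemma zpoly_pow_mult: "P \<in> zpoly_pow p \<Longrightarrow> Q \<in> zpoly_pow p \<Longrightarrow> P * Q \<in> zpoly_pow p"
  using Poly_Mapping.keys_mult[of P Q] unfolding zpoly_pow_def by (fastforce simp: lookup_add)

lemma zpoly_pow_sum: "(\<And>x. x \<in> A \<Longrightarrow> f x \<in> zpoly_pow p) \<Longrightarrow> sum f A \<in> zpoly_pow p"
  by (induction A rule: infinite_finite_induct) (auto simp: zpoly_pow_add)

lemma zrat_pow_iff:
  "f \<in> zrat_pow p \<longleftrightarrow> (\<exists>P\<in>zpoly_pow p. \<exists>Q\<in>zpoly_pow p. Q \<noteq> 0 \<and> f = to_fract P / to_fract Q)"
  unfolding zrat_pow_def by (auto simp: Fract_conv_to_fract)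

lemma zrat_pow_to_fract: "P \<in> zpoly_pow p \<Longrightarrow> to_fract P \<in> zrat_pow p"
  unfolding zrat_pow_iff by (intro bexI[of _ P] bexI[of _ 1]) simp_all

lemma zrat_pow_0 [simp]: "0 \<in> zrat_pow p"
  using zrat_pow_to_fract[of 0] by simp

lemma zrat_pow_zconst [simp]: "zconst c \<in> zrat_pow p"
  by (simp add: zconst_def zrat_pow_to_fract)

lemma zrat_pow_1 [simp]: "1 \<in> zrat_pow p"
  using zrat_pow_zconst[of 1] by simp

lemma zrat_pow_of_nat [simp]: "of_nat n \<in> zrat_pow p"
  using zrat_pow_zconst[of "of_nat n"] by simp

lemma zrat_pow_mult: "f \<in> zrat_pow p \<Longrightarrow> g \<in> zrat_pow p \<Longrightarrow> f * g \<in> zrat_pow p"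
  unfolding zrat_pow_iff
proof (elim bexE conjE)
  fix P Q P' Q' :: "'a zpoly"
  assume "P \<in> zpoly_pow p" "Q \<in> zpoly_pow p" "Q \<noteq> 0" "f = to_fract P / to_fract Q"
    "P' \<in> zpoly_pow p" "Q' \<in> zpoly_pow p" "Q' \<noteq> 0" "g = to_fract P' / to_fract Q'"
  then show "\<exists>P\<in>zpoly_pow p. \<exists>Q\<in>zpoly_pow p. Q \<noteq> 0 \<and> f * g = to_fract P / to_fract Q"
    by (intro bexI[of _ "P * P'"] bexI[of _ "Q * Q'"]) (simp_all add: zpoly_pow_mult to_fract_mult')
qed

lemma zrat_pow_add: "f \<in> zrat_pow p \<Longrightarrow> g \<in> zrat_pow p \<Longrightarrow> f + g \<in> zrat_pow p"
  unfolding zrat_pow_iff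
proof (elim bexE conjE)
  fix P Q P' Q' :: "'a zpoly"
  assume "P \<in> zpoly_pow p" "Q \<in> zpoly_pow p" "Q \<noteq> 0" "f = to_fract P / to_fract Q"
    "P' \<in> zpoly_pow p" "Q' \<in> zpoly_pow p" "Q' \<noteq> 0" "g = to_fract P' / to_fract Q'"
  then show "\<exists>P\<in>zpoly_pow p. \<exists>Q\<in>zpoly_pow p. Q \<noteq> 0 \<and> f + g = to_fract P / to_fract Q"
    by (intro bexI[of _ "P * Q' + P' * Q"] bexI[of _ "Q * Q'"])
      (simp_all add: zpoly_pow_mult zpoly_pow_add to_fract_mult' add_frac_eq)
qed

lemma zrat_pow_inverse:
  assumes "f \<in> zrat_pow p"
  shows "inverse f \<in> zrat_pow p"
proof (cases "f = 0")
  case False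
  obtain P Q where "P \<in> zpoly_pow p" "Q \<in> zpoly_pow p" "Q \<noteq> 0" "f = to_fract P / to_fract Q"
    using assms unfolding zrat_pow_iff by blast
  with False show ?thesis
    unfolding zrat_pow_iff by (intro bexI[of _ Q] bexI[of _ P]) auto
qed simp

lemma zrat_pow_sum: "(\<And>x. x \<in> A \<Longrightarrow> f x \<in> zrat_pow p) \<Longrightarrow> sum f A \<in> zrat_pow p"
  by (induction A rule: infinite_finite_induct) (auto simp: zrat_pow_add)

lemma zrat_pow_prod: "(\<And>x. x \<in> A \<Longrightarrow> f x \<in> zrat_pow p) \<Longrightarrow> prod f A \<in> zrat_pow p"
  by (induction A rule: infinite_finite_induct) (auto simp: zrat_pow_mult)

lemma to_fract_power: "to_fract (P ^ n) = to_fract P ^ n"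
  by (induction n) (simp_all add: to_fract_mult')

lemma to_fract_prod: "to_fract (prod f A) = (\<Prod>x\<in>A. to_fract (f x))"
  by (induction A rule: infinite_finite_induct) (simp_all add: to_fract_mult')

lemma to_fract_single:
  "to_fract (Poly_Mapping.single m c) = zconst c * zmonom (\<lambda>j. int (Poly_Mapping.lookup m j))"
proof -
  have pow: "Poly_Mapping.single (Poly_Mapping.single j 1) 1 ^ n
      = (Poly_Mapping.single (Poly_Mapping.single j n) 1 :: 'a zpoly)" for j n
    by (induction n) (simp_all add: mult_single flip: single_add)
  have prod: "(\<Prod>j\<in>A. Poly_Mapping.single (f j) 1) = (Poly_Mapping.single (sum f A) 1 :: 'a zpoly)"
    for A :: "nat set" and f :: "nat \<Rightarrow> nat \<Rightarrow>\<^sub>0 nat"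
    by (induction A rule: infinite_finite_induct) (simp_all add: mult_single)
  have "{j. Poly_Mapping.lookup m j \<noteq> 0} = Poly_Mapping.keys m"
    by (auto simp: in_keys_iff)
  then have "zmonom (\<lambda>j. int (Poly_Mapping.lookup m j))
      = (\<Prod>j\<in>Poly_Mapping.keys m. zvar j ^ Poly_Mapping.lookup m j :: 'a zrat)"
    by (simp add: zmonom_def)
  also have "\<dots> = to_fract (Poly_Mapping.single m 1)"
    unfolding zvar_def to_fract_power[symmetric] to_fract_prod[symmetric] pow prod
    by (simp add: poly_mapping_expand[of m, symmetric])
  finally show ?thesis
    by (simp add: zconst_def mult_single flip: to_fract_mult')
qed

section \<open>The filtration of \<open>k(z)\<close> by the \<open>k(z^p)\<close>-spans of
  \<open>z^{i*}\<close>, \<open>i < m\<close>, set up so that the top coefficient can be split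
  off\<close>

primrec zspan :: "nat \<Rightarrow> nat \<Rightarrow> 'k::field zrat set" where
  "zspan p 0 = {0}"
| "zspan p (Suc m) = {g * zmonom (istar p m) + h |g h. g \<in> zrat_pow p \<and> h \<in> zspan p m}"

lemma zspan_0 [simp]: "0 \<in> zspan p m"
  by (induction m) (auto intro!: exI[of _ 0])

lemma zspan_add: "f \<in> zspan p m \<Longrightarrow> g \<in> zspan p m \<Longrightarrow> f + g \<in> zspan p m"
proof (induction m arbitrary: f g)
  case (Suc m)
  obtain a h b h' where "a \<in> zrat_pow p" "h \<in> zspan p m" "b \<in> zrat_pow p" "h' \<in> zspan p m"
    and f: "f = a * zmonom (istar p m) + h" "g = b * zmonom (istar p m) + h'"
    using Suc.prems by auto
  then have "a + b \<in> zrat_pow p" "h + h' \<in> zspan p m"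
    "f + g = (a + b) * zmonom (istar p m) + (h + h')"
    by (simp_all add: zrat_pow_add Suc.IH algebra_simps)
  then show ?case by auto
qed simp

lemma zspan_mult: "a \<in> zrat_pow p \<Longrightarrow> f \<in> zspan p m \<Longrightarrow> a * f \<in> zspan p m"
proof (induction m arbitrary: f)
  case (Suc m)
  obtain b h where "b \<in> zrat_pow p" "h \<in> zspan p m" and f: "f = b * zmonom (istar p m) + h"
    using Suc.prems by auto
  moreover have "a * f = (a * b) * zmonom (istar p m) + a * h"
    by (simp add: f algebra_simps)
  ultimately show ?case using Suc zrat_pow_mult by fastforce
qed simp

lemma zspan_sum: "(\<And>x. x \<in> A \<Longrightarrow> f x \<in> zspan p m) \<Longrightarrow> sum f A \<in> zspan p m"
  by (induction A rule: infinite_finite_induct) (auto simp: zspan_add)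

lemma zspan_Suc_mono: "zspan p m \<subseteq> zspan p (Suc m)"
proof
  fix f assume "f \<in> zspan p m"
  then show "f \<in> zspan p (Suc m)"
    by (simp, intro exI[of _ 0] exI[of _ f]) simp
qed

lemma zspan_mono: "m \<le> n \<Longrightarrow> zspan p m \<subseteq> zspan p n"
  using lift_Suc_mono_le[of "zspan p" m n] zspan_Suc_mono by blast

lemma zmonom_in_zspan: "i < m \<Longrightarrow> zmonom (istar p i) \<in> zspan p m"
proof -
  assume "i < m"
  moreover have "zmonom (istar p i) \<in> zspan p (Suc i)"
    by (simp, intro exI[of _ 1] exI[of _ 0]) simp
  ultimately show ?thesis using zspan_mono[of "Suc i" m] by (auto simp del: zspan.simps)
qed

lemma zspan_iff:
  "f \<in> zspan p m \<longleftrightarrow> (\<exists>g. (\<forall>i. g i \<in> zrat_pow p) \<and> f = (\<Sum>i<m. g i * zmonom (istar p i)))"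
proof
  show "f \<in> zspan p m \<Longrightarrow> \<exists>g. (\<forall>i. g i \<in> zrat_pow p) \<and> f = (\<Sum>i<m. g i * zmonom (istar p i))"
  proof (induction m arbitrary: f)
    case (Suc m)
    obtain a h where f: "a \<in> zrat_pow p" "h \<in> zspan p m" "f = a * zmonom (istar p m) + h"
      using Suc.prems by auto
    obtain g where "\<forall>i. g i \<in> zrat_pow p" "h = (\<Sum>i<m. g i * zmonom (istar p i))"
      using Suc.IH[OF f(2)] by blast
    with f show ?case by (intro exI[of _ "g(m := a)"]) simp
  qed (auto intro!: exI[of _ "\<lambda>_. 0"])
qed (auto intro!: zspan_sum zspan_mult zmonom_in_zspan)

lemma zmonom_istar_0 [simp]: "zmonom (istar p 0) = 1"
  by (simp add: zmonom_def istar_def)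

text \<open>\<open>field_type\<close> pins down the type \<open>'k\<close>, whose characteristic
  \<open>p\<close> is.\<close>

locale prime_char =
  fixes p :: nat and field_type :: "'k::field itself"
  assumes char: "CHAR('k) = p" and prime: "prime p"
begin

lemma p_pos: "p > 0" and p_gt_1: "p > 1"
  using prime_gt_0_nat[OF prime] prime_gt_1_nat[OF prime] .

lemma less_power_p: "i < p ^ i"
  using p_gt_1 by (intro power_gt_expt) simp

lemma of_nat_eq_0: "of_nat n = (0 :: 'k) \<longleftrightarrow> p dvd n"
  by (simp add: of_nat_eq_0_iff_char_dvd char)

lemma of_nat_zrat_eq_0: "of_nat n = (0 :: 'k zrat) \<longleftrightarrow> p dvd n"
  by (simp add: of_nat_eq_0_iff_char_dvd char)

section \<open>Frobenius, and generation of \<open>k(z)\<close> over \<open>k(z^p)\<close> by the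
  \<open>z^{i*}\<close>\<close>

lemma zdiff_zpoly_pow:
  assumes "P \<in> zpoly_pow p"
  shows "zdiff_poly (P :: 'k zpoly) = 0"
proof -
  have "of_nat (Poly_Mapping.lookup m j) = (0 :: 'k)" if "m \<in> Poly_Mapping.keys P" for m j
    using assms that by (simp add: zpoly_pow_def of_nat_eq_0)
  then show ?thesis
    unfolding zdiff_poly_def by (intro sum.neutral ballI) simp
qed

lemma zdiff_zrat_pow: "f \<in> zrat_pow p \<Longrightarrow> zdiff (f :: 'k zrat) = 0"
  unfolding zrat_pow_def by (auto simp: zdiff_Fract zdiff_zpoly_pow)

text \<open>Frobenius is additive, so it suffices to look at single terms.\<close>

lemma zpoly_power_p: "(P :: 'k zpoly) ^ p \<in> zpoly_pow p"
proof -
  have "P ^ p = (\<Sum>m\<in>Poly_Mapping.keys P. Poly_Mapping.single m (Poly_Mapping.lookup P m) ^ p)"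
    by (subst poly_mapping_expand[of P]) (simp add: freshmans_dream_sum char prime)
  also have "\<dots> \<in> zpoly_pow p"
  proof (rule zpoly_pow_sum)
    fix m
    obtain m' where "Poly_Mapping.single m (Poly_Mapping.lookup P m) ^ p
        = Poly_Mapping.single m' (Poly_Mapping.lookup P m ^ p)"
      "\<forall>j. Poly_Mapping.lookup m' j = p * Poly_Mapping.lookup m j"
      using single_power[of m "Poly_Mapping.lookup P m" p] by blast
    then show "Poly_Mapping.single m (Poly_Mapping.lookup P m) ^ p \<in> zpoly_pow p"
      by (simp add: zpoly_pow_def)
  qed
  finally show ?thesis .
qed

lemma zrat_power_p: "(f :: 'k zrat) ^ p \<in> zrat_pow p"
proof (cases f)
  case (Fract P Q)
  then show ?thesis
    unfolding zrat_pow_iff using zpoly_power_p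
    by (intro bexI[of _ "P ^ p"] bexI[of _ "Q ^ p"])
      (simp_all add: Fract_conv_to_fract to_fract_power power_divide)
qed

text \<open>Only exponents modulo \<open>p\<close> matter up to factors from \<open>k(z^p)\<close>.
  The \<open>j\<close>-th exponent of \<open>z^{i*}\<close> is congruent to the \<open>j\<close>-th
  base \<open>p\<close> digit of \<open>i\<close>, so the \<open>i\<close> whose digits are the
  residues of \<open>e\<close> works; it has at most \<open>N\<close> digits, so no variable beyond
  the first \<open>N\<close> enters. Negative exponents are allowed.\<close>

lemma zmonom_reduce:
  assumes "\<And>j. j \<ge> N \<Longrightarrow> e j = 0"
  obtains g where "g \<in> zrat_pow p"
    "zmonom e = g * (zmonom (istar p (\<Sum>j<N. nat (e j mod int p) * p ^ j)) :: 'k zrat)"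
proof -
  define d where "d j = nat (e j mod int p)" for j
  define i where "i = (\<Sum>j<N. d j * p ^ j)"
  have d: "d j < p" for j using p_pos by (simp add: d_def nat_less_iff)
  have i: "i < p ^ N" unfolding i_def by (rule digit_sum_less) (rule d)
  have "zmonom e = (\<Prod>j<N. zvar j powi e j :: 'k zrat)"
    by (rule zmonom_eq_prod) (rule assms)
  also have "\<dots> = (\<Prod>j<N. zvar j powi (e j - istar p i j) * zvar j powi istar p i j)"
    by (intro prod.cong refl) (simp flip: power_int_add)
  also have "\<dots> = (\<Prod>j<N. zvar j powi (e j - istar p i j)) * (\<Prod>j<N. zvar j powi istar p i j)"
    by (rule prod.distrib)
  also have "(\<Prod>j<N. zvar j powi istar p i j) = (zmonom (istar p i) :: 'k zrat)"
    by (rule zmonom_eq_prod[symmetric]) (use istar_eq_0[OF i] p_pos in auto)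
  finally have "zmonom e = (\<Prod>j<N. zvar j powi (e j - istar p i j)) * (zmonom (istar p i) :: 'k zrat)" .
  moreover have "(\<Prod>j<N. zvar j powi (e j - istar p i j) :: 'k zrat) \<in> zrat_pow p"
  proof (rule zrat_pow_prod)
    fix j assume "j \<in> {..<N}"
    then have "i div p ^ j mod p = d j"
      unfolding i_def by (intro digit_sum_digit d) auto
    then have "istar p i j mod int p = e j mod int p"
      using p_pos by (simp add: istar_def d_def flip: zmod_int)
    then obtain k where "e j - istar p i j = int p * k"
      by (metis mod_eq_dvd_iff dvdE)
    then have "zvar j powi (e j - istar p i j) = (zvar j powi k :: 'k zrat) ^ p"
      by (simp add: mult.commute[of "int p"] power_int_mult)
    then show "zvar j powi (e j - istar p i j) \<in> (zrat_pow p :: 'k zrat set)"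
      using zrat_power_p by simp
  qed
  ultimately show thesis using that unfolding i_def d_def by blast
qed

text \<open>Each term of a polynomial reduces to a multiple of a single \<open>z^{i*}\<close>;
  fractions follow by making the denominator a \<open>p\<close>-th power.\<close>

lemma in_zspan: "\<exists>m. (f :: 'k zrat) \<in> zspan p m"
proof -
  have sum: "\<exists>m. (\<Sum>x\<in>A. h x) \<in> zspan p m"
    if "\<And>x. x \<in> A \<Longrightarrow> \<exists>m. (h x :: 'k zrat) \<in> zspan p m" for A :: "(nat \<Rightarrow>\<^sub>0 nat) set" and h
    using that
  proof (induction A rule: infinite_finite_induct)
    case (insert x A)
    then obtain m m' where "h x \<in> zspan p m" "sum h A \<in> zspan p m'" by (meson insertCI)
    then have "h x + sum h A \<in> zspan p (max m m')"
      using zspan_mono[of m "max m m'" p] zspan_mono[of m' "max m m'" p] by (auto intro: zspan_add)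
    then show ?case using insert by auto
  qed (auto intro: zspan_0)
  have poly: "\<exists>m. to_fract (P :: 'k zpoly) \<in> zspan p m" for P
  proof -
    have "\<exists>n. to_fract (Poly_Mapping.single m c :: 'k zpoly) \<in> zspan p n" for m c
    proof -
      obtain N where N: "Poly_Mapping.keys m \<subseteq> {..<N}"
        using finite_nat_iff_bounded[of "Poly_Mapping.keys m"] by auto
      obtain g i where "g \<in> zrat_pow p"
        "zmonom (\<lambda>j. int (Poly_Mapping.lookup m j)) = g * (zmonom (istar p i) :: 'k zrat)"
        by (rule zmonom_reduce[of N "\<lambda>j. int (Poly_Mapping.lookup m j)"])
          (use N in \<open>force simp: in_keys_iff\<close>)+
      then show ?thesis
        by (auto simp: to_fract_single intro!: exI[of _ "Suc i"] zspan_mult zmonom_in_zspan simp del: zspan.simps)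
    qed
    then show ?thesis
      by (subst poly_mapping_expand[of P]) (simp only: to_fract_sum' sum)
  qed
  show ?thesis
  proof (cases f)
    case (Fract P Q)
    obtain m where m: "to_fract (P * Q ^ (p - 1)) \<in> zspan p m" using poly by blast
    have "to_fract Q ^ p = to_fract Q ^ (p - 1) * to_fract Q"
      by (rule power_minus_mult[symmetric]) (rule p_pos)
    \<comment> \<open>\<open>P / Q = P Q^(p-1) / Q^p\<close>, and \<open>Q^p\<close> lies in
      \<open>k(z^p)\<close>.\<close>
    then have "f = inverse (to_fract Q ^ p) * to_fract (P * Q ^ (p - 1))"
      using Fract by (simp add: Fract_conv_to_fract to_fract_mult' to_fract_power field_simps)
    then show ?thesis
      using zspan_mult[OF zrat_pow_inverse[OF zrat_power_p] m] by auto
  qed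
qed

text \<open>Let \<open>v\<close> be the exponent of \<open>p\<close> in \<open>m + 1\<close>. In the
  sum for \<open>D z^{(m+1)*}\<close>, the term \<open>k = v\<close> is the leading one: its
  coefficient \<open>(m+1) / p^v\<close> is prime to \<open>p\<close> and its monomial is exactly
  \<open>z^{m*}\<close>. Every other term either has a coefficient divisible by \<open>p\<close> or
  reduces to an index below \<open>m\<close>.\<close>

lemma zdiff_zmonom_Suc:
  obtains a h where "a \<noteq> 0" "h \<in> zspan p m"
    "zdiff (zmonom (istar p (Suc m))) = zconst a * zmonom (istar p m) + (h :: 'k zrat)"
proof -
  define T :: "nat \<Rightarrow> 'k zrat" where
    "T k = of_nat (Suc m div p ^ k) * zmonom (\<lambda>l. istar p (Suc m) l - of_bool (l \<le> k))" for k
  define v where "v = multiplicity p (Suc m)"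
  have dvd_iff: "p ^ l dvd Suc m \<longleftrightarrow> l \<le> v" for l
    unfolding v_def by (rule power_dvd_iff_le_multiplicity) (use p_gt_1 in auto)
  have dvd_iff': "p dvd Suc m div p ^ l \<longleftrightarrow> l < v" if "l \<le> v" for l
    using dvd_div_iff_mult[of "p ^ l" "Suc m" p] dvd_iff[of l] dvd_iff[of "Suc l"] that p_pos
    by (simp add: Suc_le_eq)
  have small: "Suc m < p ^ Suc m" by (rule less_power_p)
  have "v < p ^ v" by (rule less_power_p)
  also have "\<dots> \<le> Suc m" using dvd_iff[of v] by (intro dvd_imp_le) auto
  finally have v: "v < Suc m" .
  have "zdiff (zmonom (istar p (Suc m))) = (\<Sum>k<Suc m. T k)"
    unfolding T_def by (rule zdiff_zmonom_istar[OF small p_pos])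
  also have "\<dots> = T v + (\<Sum>k\<in>{..<Suc m} - {v}. T k)"
    by (rule sum.remove) (use v in auto)
  also have "T v = zconst (of_nat (Suc m div p ^ v)) * zmonom (istar p m)"
  proof -
    \<comment> \<open>From \<open>m + 1\<close> to \<open>m\<close>, the quotient by
      \<open>p^l\<close> drops by one exactly when \<open>p^l\<close> divides \<open>m + 1\<close>,
      that is, when \<open>l \<le> v\<close>.\<close>
    have "istar p (Suc m) l - of_bool (l \<le> v) = istar p m l" for l
      using dvd_iff[of l] by (auto simp: istar_def div_Suc dvd_eq_mod_eq_0)
    then show ?thesis by (simp add: T_def)
  qed
  finally have "zdiff (zmonom (istar p (Suc m)))
    = zconst (of_nat (Suc m div p ^ v)) * zmonom (istar p m) + (\<Sum>k\<in>{..<Suc m} - {v}. T k)" .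
  moreover have "of_nat (Suc m div p ^ v) \<noteq> (0 :: 'k)"
    using dvd_iff'[of v] by (simp add: of_nat_eq_0)
  moreover have "(\<Sum>k\<in>{..<Suc m} - {v}. T k) \<in> zspan p m"
  proof (rule zspan_sum)
    fix k assume "k \<in> {..<Suc m} - {v}"
    then have k: "k < Suc m" "k \<noteq> v" by auto
    show "T k \<in> zspan p m"
    proof (cases "p dvd Suc m div p ^ k")
      case True
      then have "T k = 0" by (simp only: T_def of_nat_zrat_eq_0[THEN iffD2] mult_zero_left)
      then show ?thesis by simp
    next
      case False
      define e where "e = (\<lambda>l. istar p (Suc m) l - of_bool (l \<le> k))"
      \<comment> \<open>For \<open>k < v\<close> the coefficient would be divisible by
        \<open>p\<close>, so here \<open>k > v\<close>.\<close>
      have "\<not> p ^ k dvd Suc m"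
        using dvd_iff[of k] dvd_iff'[of k] False k by auto
      then have mod_pos: "Suc m mod p ^ k > 0" by (simp add: dvd_eq_mod_eq_0)
      \<comment> \<open>The \<open>k\<close>-th digit of \<open>m + 1\<close> is nonzero in this
        case, so it is lowered without a borrow.\<close>
      have e_mod: "nat (e k mod int p) + 1 = Suc m div p ^ k mod p"
      proof -
        have "nat ((int x - 1) mod int p) + 1 = x mod p" if "\<not> p dvd x" for x
        proof -
          have "x mod p > 0" using that by (simp add: dvd_eq_mod_eq_0)
          then have "(int x - 1) mod int p = int (x mod p) - 1"
            using mod_less_divisor[OF p_pos, of x]
            by (subst mod_diff_left_eq[symmetric]) (simp add: zmod_int[symmetric])
          then show ?thesis using \<open>x mod p > 0\<close> by simp
        qed
        from this[OF False] show ?thesis by (simp add: e_def istar_def)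
      qed
      have "(\<Sum>l<Suc m. nat (e l mod int p) * p ^ l) + (\<Sum>l<k. Suc m div p ^ l mod p * p ^ l)
          < (\<Sum>l<Suc m. Suc m div p ^ l mod p * p ^ l)"
      proof (rule digit_sum_decrease[OF k(1)])
        show "nat (e l mod int p) < p" for l using p_pos by (simp add: nat_less_iff)
        show "nat (e l mod int p) = Suc m div p ^ l mod p" if "k < l" for l
          using that by (simp add: e_def istar_def flip: zmod_int)
      qed (use e_mod in simp)
      \<comment> \<open>The digits of \<open>m + 1\<close> below \<open>k\<close> add up to
        \<open>(m + 1) mod p^k\<close>, which is positive; this gap sharpens the bound
        \<open>m + 1\<close> to \<open>m\<close>.\<close>
      then have less: "(\<Sum>l<Suc m. nat (e l mod int p) * p ^ l) < m"
        unfolding digit_sum_mod mod_less[OF small] using mod_pos by linarith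
      have e_0: "e l = 0" if "l \<ge> Suc m" for l
        using that k istar_eq_0[OF small that p_pos] by (simp add: e_def)
      obtain g where "g \<in> zrat_pow p"
        "zmonom e = g * (zmonom (istar p (\<Sum>l<Suc m. nat (e l mod int p) * p ^ l)) :: 'k zrat)"
        by (rule zmonom_reduce[OF e_0])
      then show ?thesis
        unfolding T_def e_def[symmetric] using zmonom_in_zspan[OF less]
        by (auto intro!: zspan_mult)
    qed
  qed
  ultimately show thesis using that by blast
qed

text \<open>\<open>D\<close> kills the coefficients from \<open>k(z^p)\<close>, so it acts on the
  \<open>z^{i*}\<close> alone; at the bottom, \<open>zspan p 1\<close> is \<open>k(z^p)\<close>
  itself.\<close>

lemma zdiff_zspan_Suc: "f \<in> zspan p (Suc m) \<Longrightarrow> zdiff (f :: 'k zrat) \<in> zspan p m"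
proof (induction m arbitrary: f)
  case 0
  then show ?case by (auto simp: zdiff_zrat_pow)
next
  case (Suc m)
  obtain g h where g: "g \<in> zrat_pow p" and h: "h \<in> zspan p (Suc m)"
    and f: "f = g * zmonom (istar p (Suc m)) + h"
    using Suc.prems by auto
  obtain a h' where "h' \<in> zspan p m"
    and a: "zdiff (zmonom (istar p (Suc m))) = zconst a * zmonom (istar p m) + (h' :: 'k zrat)"
    by (rule zdiff_zmonom_Suc)
  then have "zdiff (zmonom (istar p (Suc m)) :: 'k zrat) \<in> zspan p (Suc m)" by fastforce
  with g have "g * zdiff (zmonom (istar p (Suc m))) \<in> zspan p (Suc m)" by (rule zspan_mult)
  moreover have "zdiff h \<in> zspan p (Suc m)"
    using Suc.IH[OF h] zspan_Suc_mono by blast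
  ultimately show ?case
    using zspan_add by (simp add: f zdiff_add zdiff_mult zdiff_zrat_pow[OF g] del: zspan.simps)
qed

lemma funpow_zdiff_zspan: "f \<in> zspan p m \<Longrightarrow> (zdiff ^^ m) (f :: 'k zrat) = 0"
proof (induction m arbitrary: f)
  case (Suc m)
  then show ?case using zdiff_zspan_Suc[of f m] by (simp add: funpow_Suc_right del: zspan.simps funpow.simps)
qed simp

text \<open>Each application of \<open>D\<close> lowers the leading index by one with a nonzero
  factor, and the remainder dies in the remaining steps.\<close>

lemma funpow_zdiff_zmonom:
  obtains a where "a \<noteq> 0" "(zdiff ^^ m) (zmonom (istar p m)) = zconst (a :: 'k)"
proof (induction m arbitrary: thesis)
  case 0
  show ?case by (rule 0[of 1]) simp_all
next
  case (Suc m)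
  obtain b where b: "b \<noteq> 0" "(zdiff ^^ m) (zmonom (istar p m)) = zconst (b :: 'k)"
    by (rule Suc.IH)
  obtain a h where a: "a \<noteq> 0" "h \<in> zspan p m"
    "zdiff (zmonom (istar p (Suc m))) = zconst a * zmonom (istar p m) + (h :: 'k zrat)"
    by (rule zdiff_zmonom_Suc)
  have "(zdiff ^^ Suc m) (zmonom (istar p (Suc m))) = zconst (a * b)"
    by (simp add: funpow_Suc_right a b funpow_zdiff_add funpow_zdiff_zspan funpow_zdiff_const_mult
        zdiff_zconst zconst_mult del: funpow.simps)
  then show ?case using Suc.prems[of "a * b"] a b by simp
qed

lemma zspan_coeff_0:
  assumes "g \<in> zrat_pow p" "h \<in> zspan p m"
    and "(zdiff ^^ m) (g * zmonom (istar p m) + h) = (0 :: 'k zrat)"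
  shows "g = 0"
proof -
  obtain a where a: "a \<noteq> 0" "(zdiff ^^ m) (zmonom (istar p m)) = zconst (a :: 'k)"
    by (rule funpow_zdiff_zmonom)
  have "(zdiff ^^ m) (g * zmonom (istar p m) + h) = g * zconst a"
    using assms(1,2) a
    by (simp add: funpow_zdiff_add funpow_zdiff_zspan funpow_zdiff_const_mult zdiff_zrat_pow)
  with assms(3) a show ?thesis by simp
qed

text \<open>Conversely, \<open>f\<close> lies in some \<open>zspan p M\<close>. As long as its top
  index is at least \<open>m\<close>, the top coefficient is detected by a power of \<open>D\<close>
  that already kills \<open>f\<close>, so the span can be shrunk.\<close>

lemma funpow_zdiff_eq_0_iff: "(zdiff ^^ m) f = 0 \<longleftrightarrow> (f :: 'k zrat) \<in> zspan p m"
proof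
  assume 0: "(zdiff ^^ m) f = 0"
  obtain M where "f \<in> zspan p M" using in_zspan by blast
  then show "f \<in> zspan p m"
  proof (induction M)
    case (Suc M)
    show ?case
    proof (cases "Suc M \<le> m")
      case True
      then show ?thesis using Suc.prems zspan_mono by blast
    next
      case False
      then have "(zdiff ^^ M) f = (zdiff ^^ (M - m)) ((zdiff ^^ m) f)"
        by (simp flip: funpow_add[unfolded o_def, THEN fun_cong] add: comp_def)
      then have "(zdiff ^^ M) f = 0" using 0 by simp
      moreover obtain g h where "g \<in> zrat_pow p" "h \<in> zspan p M" "f = g * zmonom (istar p M) + h"
        using Suc.prems by auto
      ultimately have "f \<in> zspan p M" using zspan_coeff_0[of g h M] by simp
      then show ?thesis by (rule Suc.IH)
    qed
  qed simp
qed (rule funpow_zdiff_zspan)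

lemma zmonom_istar_independent:
  assumes "\<And>i. g i \<in> zrat_pow p" "(\<Sum>i<m. g i * zmonom (istar p i)) = (0 :: 'k zrat)" "i < m"
  shows "g i = 0"
  using assms(2,3)
proof (induction m)
  case (Suc m)
  have "(\<Sum>i<m. g i * zmonom (istar p i)) \<in> zspan p m"
    unfolding zspan_iff using assms(1) by blast
  then have "g m = 0"
    using zspan_coeff_0[OF assms(1)[of m]] Suc.prems(1) by (simp add: add.commute)
  with Suc show ?case by (cases "i = m") auto
qed simp

lemma zdiff_eq_0_iff: "zdiff f = 0 \<longleftrightarrow> (f :: 'k zrat) \<in> zrat_pow p"
  using funpow_zdiff_eq_0_iff[of 1 f] by simp

end


section \<open>Polynomials in the derivation of \<open>k(z)\<close>\<close>

definition poly_zdiff :: "'k::field poly \<Rightarrow> 'k zrat \<Rightarrow> 'k zrat" where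
  "poly_zdiff q f = (\<Sum>i\<le>degree q. zconst (coeff q i) * (zdiff ^^ i) f)"

lemma poly_zdiff_superset:
  "degree q \<le> N \<Longrightarrow> poly_zdiff q f = (\<Sum>i\<le>N. zconst (coeff q i) * (zdiff ^^ i) f)"
  unfolding poly_zdiff_def by (intro sum.mono_neutral_left) (auto simp: coeff_eq_0)

lemma poly_zdiff_0 [simp]: "poly_zdiff 0 f = 0"
  by (simp add: poly_zdiff_def)

lemma poly_zdiff_1 [simp]: "poly_zdiff 1 f = f"
  by (simp add: poly_zdiff_def)

lemma poly_zdiff_add: "poly_zdiff (q + r) f = poly_zdiff q f + poly_zdiff r f"
proof -
  define N where "N = max (degree q) (degree r)"
  have "degree q \<le> N" "degree r \<le> N" "degree (q + r) \<le> N"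
    using degree_add_le_max[of q r] by (simp_all add: N_def)
  then show ?thesis
    by (simp add: poly_zdiff_superset[of _ N] zconst_add distrib_right sum.distrib)
qed

lemma poly_zdiff_smult: "poly_zdiff (smult a q) f = zconst a * poly_zdiff q f"
  by (cases "a = 0") (simp_all add: poly_zdiff_def zconst_mult sum_distrib_left mult.assoc)

lemma poly_zdiff_sum: "poly_zdiff (sum q A) f = (\<Sum>x\<in>A. poly_zdiff (q x) f)"
  by (induction A rule: infinite_finite_induct) (simp_all add: poly_zdiff_add)

lemma poly_zdiff_pCons: "poly_zdiff (pCons a q) f = zconst a * f + poly_zdiff q (zdiff f)"
proof -
  have "poly_zdiff (pCons a q) f = (\<Sum>i\<le>Suc (degree q). zconst (coeff (pCons a q) i) * (zdiff ^^ i) f)"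
    by (rule poly_zdiff_superset) (rule degree_pCons_le)
  also have "\<dots> = zconst a * f + poly_zdiff q (zdiff f)"
    unfolding sum.atMost_Suc_shift by (simp add: poly_zdiff_def funpow_Suc_right del: funpow.simps)
  finally show ?thesis .
qed

lemma poly_zdiff_linear: "poly_zdiff [:a, 1:] f = zconst a * f + zdiff f"
  by (simp add: poly_zdiff_pCons)

lemma poly_zdiff_arg_0 [simp]: "poly_zdiff q 0 = 0"
  by (simp add: poly_zdiff_def)

lemma zdiff_poly_zdiff: "zdiff (poly_zdiff q f) = poly_zdiff q (zdiff f)"
  by (induction q arbitrary: f) (simp_all add: poly_zdiff_pCons zdiff_add zdiff_zconst_mult)

lemma funpow_zdiff_poly_zdiff: "(zdiff ^^ m) (poly_zdiff q f) = poly_zdiff q ((zdiff ^^ m) f)"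
  by (induction m) (simp_all add: zdiff_poly_zdiff)

text \<open>Since \<open>D\<close> commutes with scalars from \<open>k\<close>, letting
  \<open>s\<close> act as \<open>D\<close> makes \<open>k(z)\<close> a
  \<open>k[s]\<close>-module.\<close>

lemma poly_zdiff_mult: "poly_zdiff (q * r) f = poly_zdiff q (poly_zdiff r f)"
  by (induction q)
    (simp_all add: poly_zdiff_add poly_zdiff_smult poly_zdiff_pCons zdiff_poly_zdiff
      flip: zdiff_poly_zdiff)

lemma poly_zdiff_X_power: "poly_zdiff ([:0, 1:] ^ m) f = (zdiff ^^ m) f"
  by (induction m) (simp_all add: poly_zdiff_mult poly_zdiff_linear del: mult_pCons_left)

text \<open>\<open>q(D)\<close> is a nonzero scalar plus a locally nilpotent operator: if
  \<open>D^(m+1) f = 0\<close>, then \<open>D^m q(D) f = q(0) D^m f\<close>, so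
  \<open>D^m f = 0\<close> as well, and so on down to \<open>f = 0\<close>.\<close>

lemma (in prime_char) poly_zdiff_inj:
  assumes "poly q 0 \<noteq> 0" "poly_zdiff q f = 0"
  shows "(f :: 'k zrat) = 0"
proof -
  obtain a q' where q: "q = pCons a q'" by (rule pCons_cases)
  with assms have a: "a \<noteq> 0" by simp
  obtain m where "(zdiff ^^ m) f = 0"
    using in_zspan funpow_zdiff_eq_0_iff by blast
  then show ?thesis
  proof (induction m)
    case (Suc m)
    have "0 = (zdiff ^^ m) (poly_zdiff q f)" by (simp add: assms)
    also have "\<dots> = zconst a * (zdiff ^^ m) f + poly_zdiff q' ((zdiff ^^ Suc m) f)"
      by (simp add: q poly_zdiff_pCons funpow_zdiff_add funpow_zdiff_const_mult zdiff_zconst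
          funpow_zdiff_poly_zdiff funpow_swap1)
    finally have "(zdiff ^^ m) f = 0" using Suc.prems a by simp
    then show ?case by (rule Suc.IH)
  qed simp
qed

text \<open>The shift moves the root \<open>a\<close> to \<open>0\<close>, so the shifted polynomial
  is \<open>s^m\<close> times a factor that does not vanish at \<open>0\<close> and hence acts
  injectively.\<close>

lemma (in prime_char) poly_zdiff_shift_eq_0_iff:
  assumes "q \<noteq> 0"
  shows "poly_zdiff (pcompose q [:a, 1:]) f = 0 \<longleftrightarrow> (f :: 'k zrat) \<in> zspan p (Polynomial.order a q)"
proof -
  define m where "m = Polynomial.order a q"
  obtain r where q: "q = [:- a, 1:] ^ m * r" and r: "\<not> [:- a, 1:] dvd r"
    using order_decomp[OF assms, of a] unfolding m_def by blast
  have "pcompose ([:- a, 1:] ^ m) [:a, 1:] = [:0, 1:] ^ m"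
    by (induction m) (simp_all add: pcompose_1 pcompose_mult pcompose_pCons del: mult_pCons_left)
  then have q': "pcompose q [:a, 1:] = pcompose r [:a, 1:] * [:0, 1:] ^ m"
    by (simp only: q pcompose_mult mult.commute)
  have "poly (pcompose r [:a, 1:]) 0 \<noteq> 0"
    using r by (simp add: poly_pcompose poly_eq_0_iff_dvd)
  then have "poly_zdiff (pcompose q [:a, 1:]) f = 0 \<longleftrightarrow> (zdiff ^^ m) f = 0"
    unfolding q' poly_zdiff_mult poly_zdiff_X_power using poly_zdiff_inj by auto
  then show ?thesis by (simp add: funpow_zdiff_eq_0_iff m_def)
qed

lemma (in prime_char) linear_zdiff_eq_0_iff:
  "zconst a * f + zdiff f = 0 \<longleftrightarrow> (f :: 'k zrat) \<in> zrat_pow p \<and> (f \<noteq> 0 \<longrightarrow> a = 0)"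
proof (cases "a = 0")
  case False
  then show ?thesis using poly_zdiff_inj[of "[:a, 1:]" f] by (auto simp: poly_zdiff_linear)
qed (simp add: zdiff_eq_0_iff)


section \<open>Coefficients in \<open>R\<close>\<close>

definition Rcoef :: "'k eulring \<Rightarrow> 'k::field \<Rightarrow> int \<Rightarrow> 'k zrat" where
  "Rcoef r \<tau> n = fls_nth (Poly_Mapping.lookup r \<tau>) n"

lemma Rcoef_eqI: "(\<And>\<tau> n. Rcoef r \<tau> n = Rcoef s \<tau> n) \<Longrightarrow> r = s"
  by (intro poly_mapping_eqI fls_eqI) (simp add: Rcoef_def)

lemma Rcoef_0 [simp]: "Rcoef 0 \<tau> n = 0"
  by (simp add: Rcoef_def)

lemma Rcoef_add: "Rcoef (r + s) \<tau> n = Rcoef r \<tau> n + Rcoef s \<tau> n"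
  by (simp add: Rcoef_def lookup_add)

lemma Rcoef_sum: "Rcoef (sum f A) \<tau> n = (\<Sum>x\<in>A. Rcoef (f x) \<tau> n)"
  by (induction A rule: infinite_finite_induct) (simp_all add: Rcoef_add)

lemma Rcoef_tpow: "Rcoef (tpow \<rho> f) \<tau> n = (if \<rho> = \<tau> then fls_nth f n else 0)"
  by (simp add: Rcoef_def tpow_def lookup_single when_def)

lemma lookup_tpow_mult:
  "Poly_Mapping.lookup (tpow \<rho> f * r) \<tau> = f * Poly_Mapping.lookup r (\<tau> - \<rho>)"
proof -
  have eq: "(\<tau> = l + q) = (q = \<tau> - l)" for l q by (auto simp: algebra_simps)
  show ?thesis
    by (simp add: tpow_def lookup_mult lookup_single eq when_mult)
qed

lemma Rcoef_const_mult: "Rcoef (Rconst c * r) \<tau> n = zconst c * Rcoef r \<tau> n"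
  by (simp add: Rcoef_def Rconst_def lookup_tpow_mult)

lemma Rcoef_mult_tpow_const:
  "Rcoef (r * tpow \<rho> (fls_const q)) \<tau> n = Rcoef r (\<tau> - \<rho>) n * q"
  by (subst mult.commute) (simp add: Rcoef_def lookup_tpow_mult)

lemma Rcoef_Rx_power_mult: "Rcoef (Rx ^ i * r) \<tau> n = Rcoef r \<tau> (n - int i)"
proof -
  have "Rx ^ i = (tpow 0 (fls_X ^ i) :: 'a eulring)"
    by (induction i) (simp_all add: Rx_def tpow_mult tpow_0_1)
  then show ?thesis
    by (simp add: Rcoef_def lookup_tpow_mult fls_X_power_times_conv_shift)
qed

lemma zconst_of_int [simp]: "zconst (of_int n) = of_int n"
  by (cases n rule: int_cases2) (simp_all add: zconst_uminus)

text \<open>The derivation lowers the power of \<open>x\<close> by one, so the coefficient at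
  \<open>x^n\<close> comes from \<open>x^(n+1)\<close>, where \<open>x\<partial>\<close> acts as
  \<open>\<tau> + n + 1 + D\<close>.\<close>

lemma Rcoef_Rdiff:
  "Rcoef (Rdiff r) \<tau> n = poly_zdiff [:\<tau> + of_int (n + 1), 1:] (Rcoef r \<tau> (n + 1))"
proof -
  have "fls_nth (fls_const a * fls_X_inv * f) n = a * fls_nth f (n + 1)"
    for a and f :: "'a zrat fls"
  proof -
    have "fls_const a * fls_X_inv * f = fls_X_inv * (fls_const a * f)" by (simp only: mult_ac)
    then show ?thesis by (simp add: fls_X_inv_times_conv_shift)
  qed
  moreover have "fls_nth (ldiff f) n = of_int (n + 1) * fls_nth f (n + 1) + zdiff (fls_nth f (n + 1))"
    for f :: "'a zrat fls"
    by (simp add: ldiff_def fls_X_inv_times_conv_shift)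
  ultimately show ?thesis
    by (simp only: Rcoef_def Rdiff.rep_eq fls_plus_nth poly_zdiff_linear zconst_add zconst_of_int)
      (simp add: algebra_simps)
qed

text \<open>This is \<open>x^i \<partial>^i = s(s-1)...(s-i+1)\<close> for
  \<open>s = x\<partial>\<close>, read off at one coefficient.\<close>

lemma Rcoef_funpow_Rdiff:
  "Rcoef ((Rdiff ^^ i) r) \<tau> n
    = poly_zdiff (\<Prod>j<i. [:\<tau> + of_int (n + int i) - of_nat j, 1:]) (Rcoef r \<tau> (n + int i))"
proof (induction i arbitrary: n)
  case (Suc i)
  have "Rcoef ((Rdiff ^^ Suc i) r) \<tau> n
      = poly_zdiff [:\<tau> + of_int (n + 1), 1:] (Rcoef ((Rdiff ^^ i) r) \<tau> (n + 1))"
    by (simp add: Rcoef_Rdiff)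
  also have "\<dots> = poly_zdiff ([:\<tau> + of_int (n + 1), 1:] * (\<Prod>j<i. [:\<tau> + of_int (n + 1 + int i) - of_nat j, 1:]))
      (Rcoef r \<tau> (n + 1 + int i))"
    unfolding Suc.IH poly_zdiff_mult ..
  \<comment> \<open>The outermost derivation meets the lowest power of \<open>x\<close> and so
    supplies the last factor, \<open>j = i\<close>.\<close>
  also have "[:\<tau> + of_int (n + 1), 1:] = [:\<tau> + of_int (n + 1 + int i) - of_nat i, 1:]"
    by simp
  also have "n + 1 + int i = n + int (Suc i)" by simp
  finally show ?case by (simp only: prod.lessThan_Suc mult.commute)
qed simp

text \<open>The factor \<open>x^i\<close> undoes the shift of \<open>\<partial>^i\<close>, so an
  Euler operator acts on each coefficient separately.\<close>

lemma Rcoef_euler_op: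
  "Rcoef (euler_op c n y) \<tau> m = poly_zdiff (pcompose (indicial_poly c n) [:\<tau> + of_int m, 1:]) (Rcoef y \<tau> m)"
proof -
  have lin: "pcompose [:- of_nat j, 1:] [:a, 1:] = [:a - of_nat j, 1:]" for j and a :: 'a
    by (simp add: pcompose_pCons)
  have "Rcoef (euler_op c n y) \<tau> m
      = (\<Sum>i\<le>n. zconst (c i) * poly_zdiff (\<Prod>j<i. [:\<tau> + of_int m - of_nat j, 1:]) (Rcoef y \<tau> m))"
    by (simp add: euler_op_def Rcoef_sum mult.assoc Rcoef_const_mult Rcoef_Rx_power_mult Rcoef_funpow_Rdiff)
  also have "\<dots> = poly_zdiff (pcompose (indicial_poly c n) [:\<tau> + of_int m, 1:]) (Rcoef y \<tau> m)"
    unfolding indicial_poly_def pcompose_sum pcompose_smult pcompose_prod lin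
      poly_zdiff_sum poly_zdiff_smult ..
  finally show ?thesis .
qed

lemma Rcoef_bounded_below: "\<exists>N. \<forall>\<tau> n. n < N \<longrightarrow> Rcoef r \<tau> n = 0"
proof -
  \<comment> \<open>The inserted \<open>0\<close> keeps the minimum defined for
    \<open>r = 0\<close>.\<close>
  define N where "N = Min (insert 0 ((\<lambda>\<tau>. fls_subdegree (Poly_Mapping.lookup r \<tau>)) ` Poly_Mapping.keys r))"
  have "Rcoef r \<tau> n = 0" if "n < N" for \<tau> n
  proof (cases "\<tau> \<in> Poly_Mapping.keys r")
    case True
    then have "N \<le> fls_subdegree (Poly_Mapping.lookup r \<tau>)"
      unfolding N_def by (intro Min_le) auto
    with that show ?thesis by (simp add: Rcoef_def)
  qed (simp add: Rcoef_def in_keys_iff)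
  then show ?thesis by blast
qed

section \<open>The prime field, and coefficients of constants\<close>

lemma (in prime_char) of_int_eq_0: "of_int n = (0 :: 'k) \<longleftrightarrow> int p dvd n"
  by (simp add: of_int_eq_0_iff_char_dvd char)

lemma (in prime_char) of_int_prime_field: "\<exists>\<sigma><p. of_int n = (of_nat \<sigma> :: 'k)"
proof (intro exI conjI)
  show "nat (n mod int p) < p" using p_pos by (simp add: nat_less_iff)
  have "of_int n - of_nat (nat (n mod int p)) = (of_int (n - n mod int p) :: 'k)"
    using p_pos by simp
  also have "\<dots> = 0" unfolding of_int_eq_0 by (simp add: minus_mod_eq_mult_div)
  finally show "of_int n = (of_nat (nat (n mod int p)) :: 'k)" by simp
qed

lemma (in prime_char) of_nat_eq_iff: "\<sigma> < p \<Longrightarrow> \<sigma>' < p \<Longrightarrow> of_nat \<sigma> = (of_nat \<sigma>' :: 'k) \<longleftrightarrow> \<sigma> = \<sigma>'"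
proof
  assume less: "\<sigma> < p" "\<sigma>' < p" and "of_nat \<sigma> = (of_nat \<sigma>' :: 'k)"
  then have "of_int (int \<sigma> - int \<sigma>') = (0 :: 'k)" by simp
  then have "int \<sigma> mod int p = int \<sigma>' mod int p"
    unfolding of_int_eq_0 by (simp add: mod_eq_dvd_iff)
  with less show "\<sigma> = \<sigma>'" by simp
qed simp

text \<open>A family supported on \<open>\<tau> = -n\<close> involves only exponents from the prime
  field, hence finitely many, and the bound \<open>N\<close> makes each component a Laurent series;
  so it is an element of \<open>R\<close>.\<close>

lemma (in prime_char) Rcoef_construct:
  assumes "\<And>n. n < N \<Longrightarrow> h n = (0 :: 'k zrat)"
  obtains r where "\<And>\<tau> n. Rcoef r \<tau> n = (if \<tau> + of_int n = 0 then h n else 0)"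
proof -
  define g :: "'k \<Rightarrow> int \<Rightarrow> 'k zrat" where "g \<tau> = (\<lambda>n. if \<tau> + of_int n = 0 then h n else 0)" for \<tau>
  have nth: "fls_nth (Abs_fls (g \<tau>)) n = g \<tau> n" for \<tau> n
    by (rule nth_Abs_fls_lower_bound[of N]) (simp add: g_def assms)
  have "{\<tau>. Abs_fls (g \<tau>) \<noteq> 0} \<subseteq> of_nat ` {..<p}"
  proof
    fix \<tau> assume "\<tau> \<in> {\<tau>. Abs_fls (g \<tau>) \<noteq> 0}"
    then obtain n where "g \<tau> n \<noteq> 0" by (auto simp: fls_eq_iff nth)
    then have "\<tau> + of_int n = 0" by (auto simp: g_def split: if_splits)
    then have "\<tau> = of_int (- n)" by (simp add: eq_neg_iff_add_eq_0)
    moreover obtain \<sigma> where "\<sigma> < p" "of_int (- n) = (of_nat \<sigma> :: 'k)"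
      using of_int_prime_field by blast
    ultimately have "\<tau> = of_nat \<sigma>" by simp
    with \<open>\<sigma> < p\<close> show "\<tau> \<in> of_nat ` {..<p}" by simp
  qed
  then have "finite {\<tau>. Abs_fls (g \<tau>) \<noteq> 0}" by (rule finite_subset) simp
  then have "Rcoef (Abs_poly_mapping (\<lambda>\<tau>. Abs_fls (g \<tau>))) \<tau> n = g \<tau> n" for \<tau> n
    by (simp add: Rcoef_def nth)
  then show thesis using that unfolding g_def by blast
qed

text \<open>In \<open>t^\<sigma> x^(p-\<sigma>) (x^p)^k\<close> the exponents of \<open>t\<close>
  and \<open>x\<close> add up to \<open>0\<close> in \<open>k\<close>. Conversely,
  \<open>\<tau> + n = 0\<close> forces \<open>\<tau>\<close> into the prime field and fixes
  \<open>n\<close> modulo \<open>p\<close>.\<close>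

lemma (in prime_char) Rconstants_iff:
  "r \<in> Rconstants p \<longleftrightarrow>
    (\<forall>\<tau> n. Rcoef r \<tau> n \<in> zrat_pow p \<and> (Rcoef r \<tau> n \<noteq> 0 \<longrightarrow> \<tau> + of_int n = (0 :: 'k)))"
proof -
  have coef: "Rcoef (\<Sum>\<sigma><p. tpow (of_nat \<sigma>) (fls_X ^ (p - \<sigma>) * g \<sigma>)) \<tau> n
      = (\<Sum>\<sigma><p. if of_nat \<sigma> = \<tau> then fls_nth (g \<sigma>) (n - int (p - \<sigma>)) else 0)"
    for g :: "nat \<Rightarrow> 'k zrat fls" and \<tau> n
    by (simp add: Rcoef_sum Rcoef_tpow fls_X_power_times_conv_shift algebra_simps cong: if_cong)
  have of_p: "of_nat p = (0 :: 'k)" by (simp add: of_nat_eq_0)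
  show ?thesis
  proof (intro iffI allI)
    fix \<tau> n
    assume "r \<in> Rconstants p"
    then obtain g where g: "\<And>\<sigma>. \<sigma> < p \<Longrightarrow> g \<sigma> \<in> laurent_pow p"
      and r: "Rcoef r \<tau> n = (\<Sum>\<sigma><p. if of_nat \<sigma> = \<tau> then fls_nth (g \<sigma>) (n - int (p - \<sigma>)) else 0)"
      unfolding Rconstants_def using coef by blast
    have "Rcoef r \<tau> n \<in> zrat_pow p"
      unfolding r by (rule zrat_pow_sum) (use g in \<open>auto simp: laurent_pow_def\<close>)
    moreover have "\<tau> + of_int n = 0" if "Rcoef r \<tau> n \<noteq> 0"
    proof -
      obtain \<sigma> where s: "\<sigma> < p" "of_nat \<sigma> = \<tau>" "fls_nth (g \<sigma>) (n - int (p - \<sigma>)) \<noteq> 0"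
        using \<open>Rcoef r \<tau> n \<noteq> 0\<close> unfolding r by (auto elim!: sum.not_neutral_contains_not_neutral split: if_splits)
      then have "int p dvd n - int (p - \<sigma>)" using g by (auto simp: laurent_pow_def)
      then have "of_int (n - int (p - \<sigma>)) = (0 :: 'k)" by (simp only: of_int_eq_0)
      with s show ?thesis by (simp add: of_nat_diff of_p add.commute)
    qed
    ultimately show "Rcoef r \<tau> n \<in> zrat_pow p \<and> (Rcoef r \<tau> n \<noteq> 0 \<longrightarrow> \<tau> + of_int n = 0)" by blast
  next
    assume r: "\<forall>\<tau> n. Rcoef r \<tau> n \<in> zrat_pow p \<and> (Rcoef r \<tau> n \<noteq> 0 \<longrightarrow> \<tau> + of_int n = 0)"
    \<comment> \<open>The summand is forced: the component at \<open>t^\<sigma>\<close> divided by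
      \<open>x^(p-\<sigma>)\<close>.\<close>
    define g where "g \<sigma> = fls_shift (int (p - \<sigma>)) (Poly_Mapping.lookup r (of_nat \<sigma>))" for \<sigma>
    have nth: "fls_nth (g \<sigma>) n = Rcoef r (of_nat \<sigma>) (n + int (p - \<sigma>))" for \<sigma> n
      by (simp add: g_def Rcoef_def)
    have "g \<sigma> \<in> laurent_pow p" if "\<sigma> < p" for \<sigma>
    proof -
      have "int p dvd n" if "Rcoef r (of_nat \<sigma>) (n + int (p - \<sigma>)) \<noteq> 0" for n
      proof -
        have "of_nat \<sigma> + of_int (n + int (p - \<sigma>)) = (0 :: 'k)" using r that by blast
        then show ?thesis using \<open>\<sigma> < p\<close> by (simp add: of_nat_diff of_p of_int_eq_0)
      qed
      with r show ?thesis by (simp add: laurent_pow_def nth)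
    qed
    moreover have "r = (\<Sum>\<sigma><p. tpow (of_nat \<sigma>) (fls_X ^ (p - \<sigma>) * g \<sigma>))"
    proof (rule Rcoef_eqI)
      fix \<tau> n
      have "Rcoef (\<Sum>\<sigma><p. tpow (of_nat \<sigma>) (fls_X ^ (p - \<sigma>) * g \<sigma>)) \<tau> n
          = (\<Sum>\<sigma><p. if of_nat \<sigma> = \<tau> then Rcoef r \<tau> n else 0)"
        unfolding coef nth by (intro sum.cong) auto
      also have "\<dots> = Rcoef r \<tau> n"
      proof (cases "Rcoef r \<tau> n = 0")
        case False
        then have "\<tau> = of_int (- n)" using r by (auto simp: eq_neg_iff_add_eq_0)
        then obtain \<sigma>\<^sub>0 where "\<sigma>\<^sub>0 < p" "\<tau> = of_nat \<sigma>\<^sub>0" using of_int_prime_field by metis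
        then have "(\<Sum>\<sigma><p. if of_nat \<sigma> = \<tau> then Rcoef r \<tau> n else 0) = (\<Sum>\<sigma><p. if \<sigma> = \<sigma>\<^sub>0 then Rcoef r \<tau> n else 0)"
          by (intro sum.cong) (auto simp: of_nat_eq_iff)
        with \<open>\<sigma>\<^sub>0 < p\<close> show ?thesis by simp
      qed (simp cong: if_cong)
      finally show "Rcoef r \<tau> n = Rcoef (\<Sum>\<sigma><p. tpow (of_nat \<sigma>) (fls_X ^ (p - \<sigma>) * g \<sigma>)) \<tau> n" ..
    qed
    ultimately show "r \<in> Rconstants p" unfolding Rconstants_def by blast
  qed
qed

lemma (in prime_char) Rdiff_eq_0_iff: "Rdiff r = 0 \<longleftrightarrow> (r :: 'k eulring) \<in> Rconstants p"
proof -
  \<comment> \<open>Reading \<open>\<partial>r\<close> at \<open>x^(n-1)\<close> refers the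
    condition to the coefficient of \<open>r\<close> at \<open>x^n\<close>.\<close>
  have "Rdiff r = 0 \<longleftrightarrow> (\<forall>\<tau> n. Rcoef (Rdiff r) \<tau> (n - 1) = 0)"
    by (metis Rcoef_0 Rcoef_eqI add_diff_cancel_right')
  then show ?thesis
    unfolding Rconstants_iff by (simp add: Rcoef_Rdiff poly_zdiff_linear linear_zdiff_eq_0_iff)
qed


section \<open>The field of constants\<close>

text \<open>
  Since \<open>t^{p\<rho>} = 1\<close>, the \<open>p\<close>-th power of \<open>r\<close> depends only on its augmentation (\<open>t^\<rho> \<mapsto> 1\<close>), so \<open>r\<close> is
  invertible as soon as the augmentation is nonzero. For a constant \<open>r \<noteq> 0\<close> the coefficients cannot
  cancel in the augmentation, because the \<open>t^\<sigma>\<close> occur with different powers of \<open>x\<close>.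
\<close>

definition Raug :: "'k eulring \<Rightarrow> 'k::field zrat fls" where
  "Raug r = (\<Sum>\<rho>\<in>Poly_Mapping.keys r. Poly_Mapping.lookup r \<rho>)"

lemma (in prime_char) power_p_eq_Raug: "(r :: 'k eulring) ^ p = tpow 0 (Raug r ^ p)"
proof -
  have pow: "tpow \<rho> f ^ m = tpow (of_nat m * \<rho>) (f ^ m)" for \<rho> :: 'k and f m
    by (induction m) (simp_all add: tpow_0_1 tpow_mult algebra_simps)
  have of_p: "of_nat p = (0 :: 'k)" by (simp add: of_nat_eq_0)
  have sum: "tpow 0 (sum f A) = (\<Sum>x\<in>A. tpow (0 :: 'k) (f x))" for f and A :: "'k set"
    by (induction A rule: infinite_finite_induct) (simp_all add: tpow_add, simp_all add: tpow_def)
  have "r = (\<Sum>\<rho>\<in>Poly_Mapping.keys r. tpow \<rho> (Poly_Mapping.lookup r \<rho>))"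
    unfolding tpow_def by (rule poly_mapping_expand)
  then have "r ^ p = (\<Sum>\<rho>\<in>Poly_Mapping.keys r. tpow \<rho> (Poly_Mapping.lookup r \<rho>)) ^ p"
    by (rule arg_cong)
  also have "\<dots> = (\<Sum>\<rho>\<in>Poly_Mapping.keys r. tpow \<rho> (Poly_Mapping.lookup r \<rho>) ^ p)"
    by (rule freshmans_dream_sum) (simp_all add: char prime)
  also have "\<dots> = tpow 0 (\<Sum>\<rho>\<in>Poly_Mapping.keys r. Poly_Mapping.lookup r \<rho> ^ p)"
    by (simp add: pow of_p sum)
  also have "(\<Sum>\<rho>\<in>Poly_Mapping.keys r. Poly_Mapping.lookup r \<rho> ^ p) = Raug r ^ p"
    unfolding Raug_def by (rule freshmans_dream_sum[symmetric]) (simp_all add: char prime)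
  finally show ?thesis .
qed

lemma (in prime_char) Raug_nonzero:
  assumes "r \<in> Rconstants p" "r \<noteq> 0"
  shows "Raug (r :: 'k eulring) \<noteq> 0"
proof -
  obtain \<tau> n where nz: "Rcoef r \<tau> n \<noteq> 0"
    using assms(2) Rcoef_eqI[of r 0] by auto
  have conc: "\<rho> = - of_int n" if "Rcoef r \<rho> n \<noteq> 0" for \<rho>
    using assms(1) that unfolding Rconstants_iff by (simp add: eq_neg_iff_add_eq_0)
  have "\<tau> \<in> Poly_Mapping.keys r"
    using nz by (auto simp: Rcoef_def in_keys_iff)
  moreover have "fls_nth (sum f A) n = (\<Sum>x\<in>A. fls_nth (f x) n)" for f :: "'k \<Rightarrow> 'k zrat fls" and A
    by (induction A rule: infinite_finite_induct) simp_all
  then have "fls_nth (Raug r) n = (\<Sum>\<rho>\<in>Poly_Mapping.keys r. Rcoef r \<rho> n)"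
    by (simp add: Raug_def Rcoef_def)
  moreover have "(\<Sum>\<rho>\<in>Poly_Mapping.keys r - {\<tau>}. Rcoef r \<rho> n) = 0"
    using conc nz by (intro sum.neutral) auto
  ultimately have "fls_nth (Raug r) n = Rcoef r \<tau> n"
    by (simp add: sum.remove)
  with nz show ?thesis by auto
qed

lemma (in prime_char) Rconstants_inverse:
  assumes "r \<in> Rconstants p" "(r :: 'k eulring) \<noteq> 0"
  obtains s where "s \<in> Rconstants p" "r * s = 1"
proof
  \<comment> \<open>\<open>r^p\<close> is a nonzero Laurent series at \<open>t^0\<close>, hence a
    unit, and \<open>s\<close> is \<open>r^(p-1) / r^p\<close>.\<close>
  define s where "s = r ^ (p - 1) * tpow 0 (inverse (Raug r ^ p))"
  have "r * s = r ^ p * tpow 0 (inverse (Raug r ^ p))"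
    using p_pos by (simp add: s_def flip: power_Suc mult.assoc)
  also have "\<dots> = 1"
    using Raug_nonzero[OF assms] by (simp add: power_p_eq_Raug tpow_mult tpow_0_1)
  finally show rs: "r * s = 1" .
  have "Rdiff 1 = (0 :: 'k eulring)"
    using Rdiff_tpow[of 0 1] by (simp add: tpow_def)
  then have "r * Rdiff s = 0"
    using Rdiff_mult[of r s] assms(1) by (simp add: rs Rdiff_eq_0_iff[symmetric])
  \<comment> \<open>\<open>R\<close> has zero divisors, such as \<open>t^1 - 1\<close>, so
    \<open>r\<close> is cancelled by means of its inverse \<open>s\<close>.\<close>
  then have "s * (r * Rdiff s) = 0" by simp
  then have "Rdiff s = 0" using rs by (simp add: mult.assoc[symmetric] mult.commute[of s])
  then show "s \<in> Rconstants p" by (simp add: Rdiff_eq_0_iff)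
qed

section \<open>The constants as a subfield in HOL-Algebra\<close>

lemma ring_of_type_algebra_simps [simp]:
  "carrier ring_of_type_algebra = UNIV" "monoid.mult ring_of_type_algebra = (*)"
  "ring.add ring_of_type_algebra = (+)" "one ring_of_type_algebra = 1"
  "ring.zero ring_of_type_algebra = 0"
  by (auto simp: ring_of_type_algebra_def)

lemma a_inv_ring_of_type_algebra [simp]: "a_inv ring_of_type_algebra x = - (x :: 'a::comm_ring_1)"
proof -
  interpret ring "ring_of_type_algebra :: 'a ring" by (rule ring_from_type_algebra)
  show ?thesis by (rule minus_equality) simp_all
qed

text \<open>As the kernel of a derivation the constants form a subring, and the inverse of a nonzero
  constant was found to be a constant again.\<close>

lemma (in prime_char) Rconstants_subfield:
  "subfield (Rconstants p) (ring_of_type_algebra :: 'k eulring ring)"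
proof -
  interpret R: cring "ring_of_type_algebra :: 'k eulring ring" by (rule cring_from_type_algebra)
  let ?C = "Rconstants p :: 'k eulring set"
  have one: "Rdiff 1 = (0 :: 'k eulring)"
    using Rdiff_tpow[of 0 1] by (simp add: tpow_def)
  have minus: "Rdiff (- r) = 0" if "Rdiff r = 0" for r :: "'k eulring"
    using Rdiff_add[of r "- r"] that by simp
  show ?thesis
  proof (rule R.subfieldI)
    show "subcring ?C ring_of_type_algebra"
      by (intro R.subcringI' R.subringI)
        (simp_all add: Rdiff_eq_0_iff[symmetric] Rdiff_add Rdiff_mult one minus)
    have "r \<in> Units (ring_of_type_algebra\<lparr>carrier := ?C\<rparr>) \<longleftrightarrow> r \<in> ?C - {0}" for r
    proof
      assume "r \<in> ?C - {0}"
      then have r: "r \<in> ?C" "r \<noteq> 0" by auto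
      obtain s where "s \<in> ?C" "r * s = 1" by (rule Rconstants_inverse[OF r])
      then show "r \<in> Units (ring_of_type_algebra\<lparr>carrier := ?C\<rparr>)"
        using r by (auto simp: Units_def mult.commute)
    qed (auto simp: Units_def)
    then show "Units (ring_of_type_algebra\<lparr>carrier := ?C\<rparr>) = ?C - {\<zero>\<^bsub>ring_of_type_algebra\<^esub>}"
      by auto
  qed
qed


section \<open>Solutions of Euler operators\<close>

lemma degree_falling_factorial: "degree (\<Prod>j<i. [:- of_nat j, 1:] :: 'k::field poly) = i"
  by (subst degree_prod_eq_sum_degree) auto

lemma degree_indicial_poly:
  assumes "c n \<noteq> 0"
  shows "degree (indicial_poly c n) = n"
proof (rule antisym)
  show "degree (indicial_poly c n) \<le> n"
    unfolding indicial_poly_def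
    by (intro degree_sum_le) (auto intro!: degree_smult_le[THEN order_trans] simp: degree_falling_factorial)
  have "coeff (\<Prod>j<i. [:- of_nat j, 1:] :: 'a poly) n = of_bool (i = n)" if "i \<le> n" for i
  proof (cases "i = n")
    case True
    have "lead_coeff (\<Prod>j<i. [:- of_nat j, 1:] :: 'a poly) = 1"
      by (simp add: lead_coeff_prod)
    then show ?thesis using True by (simp add: degree_falling_factorial)
  qed (use that in \<open>simp add: coeff_eq_0 degree_falling_factorial\<close>)
  then have "coeff (indicial_poly c n) n = (\<Sum>i\<le>n. c i * of_bool (i = n))"
    unfolding indicial_poly_def coeff_sum coeff_smult by (intro sum.cong) auto
  also have "\<dots> = c n" by simp
  finally show "n \<le> degree (indicial_poly c n)"
    using assms by (intro le_degree) simp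
qed

text \<open>Algebraic closedness enters here: \<open>q\<close> splits into linear factors, so its
  multiset of roots has \<open>degree q\<close> elements.\<close>

lemma sum_order_alg_closed:
  assumes "(q :: 'k::alg_closed_field poly) \<noteq> 0"
  shows "(\<Sum>\<rho> | poly q \<rho> = 0. Polynomial.order \<rho> q) = degree q"
proof -
  obtain A where A: "size A = degree q" "q = smult (lead_coeff q) (\<Prod>x\<in>#A. [:- x, 1:])"
    using alg_closed_imp_factorization[OF assms] by blast
  have "proots (\<Prod>x\<in>#A. [:- x, 1:]) = A"
  proof (induction A)
    case (add x A)
    have "(\<Prod>x\<in>#A. [:- x, 1:]) \<noteq> 0" by (auto simp: prod_mset_zero_iff)
    with add show ?case by (simp add: proots_mult del: mult_pCons_left)
  qed simp
  then have "proots q = A"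
    using assms by (subst A(2)) simp
  then show ?thesis
    using assms A(1) by (simp add: size_multiset_overloaded_eq flip: set_count_proots count_proots)
qed

section \<open>Solutions as combinations of the basis\<close>

context prime_char
begin

context
  fixes c :: "nat \<Rightarrow> 'k" and n :: nat
  assumes leading: "c n \<noteq> 0"
begin

lemma indicial_nonzero: "indicial_poly c n \<noteq> 0"
  \<comment> \<open>Degree \<open>0\<close> does not exclude the zero polynomial, so for
    \<open>n = 0\<close> the value \<open>c 0\<close> is used directly.\<close>
  using degree_indicial_poly[of c n] leading by (cases "n = 0") (auto simp: indicial_poly_def)

text \<open>The condition splits into one per coefficient, governed by the multiplicity of
  \<open>\<tau> + m\<close>; where this is no root, the multiplicity is \<open>0\<close> and the
  coefficient must vanish.\<close>

lemma euler_solutions_iff: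
  "y \<in> euler_solutions c n \<longleftrightarrow> (\<forall>\<tau> m. Rcoef y \<tau> m \<in> zspan p (exponent_mult c n (\<tau> + of_int m)))"
proof -
  have "euler_op c n y = 0 \<longleftrightarrow> (\<forall>\<tau> m. Rcoef (euler_op c n y) \<tau> m = 0)"
    by (metis Rcoef_0 Rcoef_eqI)
  then show ?thesis
    by (simp add: euler_solutions_def exponent_mult_def Rcoef_euler_op
        poly_zdiff_shift_eq_0_iff[OF indicial_nonzero])
qed

lemma euler_index_eq: "euler_index c n = (SIGMA \<rho>:local_exponents c n. {..<exponent_mult c n \<rho>})"
  by (auto simp: euler_index_def)

lemma finite_local_exponents: "finite (local_exponents c n)"
  unfolding local_exponents_def by (rule poly_roots_finite) (rule indicial_nonzero)

lemma finite_euler_index: "finite (euler_index c n)"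
  unfolding euler_index_eq using finite_local_exponents by simp

text \<open>Multiplication by \<open>t^\<rho>\<close> moves the support of a constant from
  \<open>\<tau> + m = 0\<close> to \<open>\<tau> + m = \<rho>\<close>, so different
  \<open>\<rho>\<close> never meet.\<close>

lemma Rcoef_combination:
  assumes "\<And>x. x \<in> euler_index c n \<Longrightarrow> a x \<in> Rconstants p"
  shows "Rcoef (\<Sum>x\<in>euler_index c n. a x * euler_basis p x) \<tau> m
    = (\<Sum>i<exponent_mult c n (\<tau> + of_int m). Rcoef (a (\<tau> + of_int m, i)) (- of_int m) m * zmonom (istar p i))"
proof -
  define S where "S \<rho> = (\<Sum>i<exponent_mult c n \<rho>. Rcoef (a (\<rho>, i)) (\<tau> - \<rho>) m * zmonom (istar p i))" for \<rho>
  have "Rcoef (\<Sum>x\<in>euler_index c n. a x * euler_basis p x) \<tau> m = (\<Sum>\<rho>\<in>local_exponents c n. S \<rho>)"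
    unfolding S_def euler_index_eq
    by (subst sum.Sigma)
      (use finite_local_exponents in
        \<open>auto simp: Rcoef_sum euler_basis_def Rcoef_mult_tpow_const intro!: sum.cong\<close>)
  also have "\<dots> = S (\<tau> + of_int m)"
  proof -
    have 0: "S \<rho> = 0" if "\<rho> \<in> local_exponents c n" "\<rho> \<noteq> \<tau> + of_int m" for \<rho>
      unfolding S_def
    proof (intro sum.neutral ballI)
      fix i assume "i \<in> {..<exponent_mult c n \<rho>}"
      then have "a (\<rho>, i) \<in> Rconstants p"
        using that by (intro assms) (simp add: euler_index_def)
      then have "Rcoef (a (\<rho>, i)) (\<tau> - \<rho>) m = 0"
        using that(2) unfolding Rconstants_iff by (metis add_diff_eq diff_add_eq eq_iff_diff_eq_0)
      then show "Rcoef (a (\<rho>, i)) (\<tau> - \<rho>) m * zmonom (istar p i) = 0" by simp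
    qed
    show ?thesis
    proof (cases "\<tau> + of_int m \<in> local_exponents c n")
      case True
      then show ?thesis
        using 0 finite_local_exponents by (subst sum.remove[of _ "\<tau> + of_int m"]) auto
    next
      case False
      \<comment> \<open>For \<open>\<tau> + m\<close> outside the local exponents, the sum on the
        right is empty and all terms on the left vanish.\<close>
      then have "exponent_mult c n (\<tau> + of_int m) = 0"
        by (auto simp: exponent_mult_def local_exponents_def intro: order_0I)
      then have "S (\<tau> + of_int m) = 0" by (simp add: S_def)
      moreover have "(\<Sum>\<rho>\<in>local_exponents c n. S \<rho>) = 0"
        using 0 False by (intro sum.neutral) auto
      ultimately show ?thesis by simp
    qed
  qed
  finally show ?thesis by (simp add: S_def)
qed

lemma combination_in_euler_solutions:
  assumes "\<And>x. x \<in> euler_index c n \<Longrightarrow> a x \<in> Rconstants p"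
  shows "(\<Sum>x\<in>euler_index c n. a x * euler_basis p x) \<in> euler_solutions c n"
proof -
  have "Rcoef (a (\<tau> + of_int m, i)) (- of_int m) m \<in> zrat_pow p"
    if i: "i < exponent_mult c n (\<tau> + of_int m)" for \<tau> m i
  proof -
    from i have "\<tau> + of_int m \<in> local_exponents c n"
      by (intro ccontr[of "_ \<in> _"]) (simp add: exponent_mult_def local_exponents_def order_0I)
    with i have "a (\<tau> + of_int m, i) \<in> Rconstants p"
      by (intro assms) (simp add: euler_index_def)
    then show ?thesis unfolding Rconstants_iff by blast
  qed
  then have "(\<Sum>i<exponent_mult c n (\<tau> + of_int m). Rcoef (a (\<tau> + of_int m, i)) (- of_int m) m
      * zmonom (istar p i)) \<in> zspan p (exponent_mult c n (\<tau> + of_int m))" for \<tau> m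
    by (intro zspan_sum zspan_mult zmonom_in_zspan) simp_all
  then show ?thesis
    unfolding euler_solutions_iff by (simp add: Rcoef_combination assms)
qed

lemma euler_basis_independent:
  assumes a: "\<And>x. x \<in> euler_index c n \<Longrightarrow> a x \<in> Rconstants p"
    and 0: "(\<Sum>x\<in>euler_index c n. a x * euler_basis p x) = 0" and x: "x \<in> euler_index c n"
  shows "a x = 0"
proof -
  obtain \<rho> i where x_eq: "x = (\<rho>, i)" by (cases x)
  with x have \<rho>: "\<rho> \<in> local_exponents c n" and i: "i < exponent_mult c n \<rho>"
    by (auto simp: euler_index_def)
  have ax: "a (\<rho>, j) \<in> Rconstants p" if "j < exponent_mult c n \<rho>" for j
    using \<rho> that by (intro a) (simp add: euler_index_def)
  have "Rcoef (a (\<rho>, i)) (- of_int m) m = 0" for m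
  proof -
    \<comment> \<open>Cut off by \<open>0\<close>, since \<open>a\<close> is known to be constant
      only on the index set.\<close>
    define g where "g j = (if j < exponent_mult c n \<rho> then Rcoef (a (\<rho>, j)) (- of_int m) m else 0)" for j
    have g: "g j \<in> zrat_pow p" for j
      using ax[of j] unfolding g_def Rconstants_iff by simp
    have "(\<Sum>j<exponent_mult c n \<rho>. g j * zmonom (istar p j)) = 0"
      \<comment> \<open>At \<open>\<tau> = \<rho> - m\<close> exactly the terms for
        \<open>\<rho>\<close> survive, leaving a relation over \<open>k(z^p)\<close>.\<close>
      using Rcoef_combination[of a "\<rho> - of_int m" m] a by (simp add: 0 g_def)
    from zmonom_istar_independent[OF g this i] show ?thesis using i by (simp add: g_def)
  qed
  moreover have "Rcoef (a (\<rho>, i)) \<tau> m = 0" if "\<tau> \<noteq> - of_int m" for \<tau> m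
    using ax[OF i] that unfolding Rconstants_iff by (metis eq_neg_iff_add_eq_0)
  ultimately show ?thesis
    unfolding x_eq by (intro Rcoef_eqI) (metis Rcoef_0)
qed

lemma euler_solutions_combination:
  assumes "y \<in> euler_solutions c n"
  obtains a where "\<And>x. a x \<in> Rconstants p" "y = (\<Sum>x\<in>euler_index c n. a x * euler_basis p x)"
proof -
  obtain N where N: "Rcoef y \<tau> m = 0" if "m < N" for \<tau> m
    using Rcoef_bounded_below[of y] by blast
  \<comment> \<open>The choice \<open>0\<close> below \<open>N\<close> is what lets the chosen
    coefficients be assembled into Laurent series.\<close>
  define P where "P \<tau> m g \<longleftrightarrow> (\<forall>i. g i \<in> zrat_pow p) \<and> (m < N \<longrightarrow> g = (\<lambda>_. 0)) \<and>
      Rcoef y \<tau> m = (\<Sum>i<exponent_mult c n (\<tau> + of_int m). g i * zmonom (istar p i))" for \<tau> m g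
  have ex: "\<exists>g. P \<tau> m g" for \<tau> m
  proof (cases "m < N")
    case True
    then show ?thesis unfolding P_def by (intro exI[of _ "\<lambda>_. 0"]) (simp add: N)
  next
    case False
    then show ?thesis using assms unfolding P_def euler_solutions_iff zspan_iff by auto
  qed
  define g where "g \<tau> m = (SOME g. P \<tau> m g)" for \<tau> m
  have "P \<tau> m (g \<tau> m)" for \<tau> m
    unfolding g_def using ex by (rule someI_ex)
  then have g: "g \<tau> m i \<in> zrat_pow p" "m < N \<Longrightarrow> g \<tau> m = (\<lambda>_. 0)"
    and y: "Rcoef y \<tau> m = (\<Sum>i<exponent_mult c n (\<tau> + of_int m). g \<tau> m i * zmonom (istar p i))"
    for \<tau> m i
    unfolding P_def by blast+
  \<comment> \<open>The scalar for \<open>(\<rho>, i)\<close> collects the \<open>i\<close>-th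
    coefficients found at \<open>t^(\<rho>-m) x^m\<close> over all \<open>m\<close> and places them
    at \<open>t^(-m) x^m\<close>; the factor \<open>t^\<rho>\<close> moves them back.\<close>
  have "\<exists>r. \<forall>\<tau> m. Rcoef r \<tau> m = (if \<tau> + of_int m = 0 then g (fst x - of_int m) m (snd x) else 0)" for x
    by (rule Rcoef_construct[of N "\<lambda>m. g (fst x - of_int m) m (snd x)"]) (use g(2) in simp, blast)
  then have "\<forall>x. \<exists>r. \<forall>\<tau> m. Rcoef r \<tau> m
      = (if \<tau> + of_int m = 0 then g (fst x - of_int m) m (snd x) else 0)"
    by (intro allI)
  from choice[OF this] obtain a where a: "\<And>x \<tau> m. Rcoef (a x) \<tau> m
      = (if \<tau> + of_int m = 0 then g (fst x - of_int m) m (snd x) else 0)"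
    by blast
  have const: "a x \<in> Rconstants p" for x
    unfolding Rconstants_iff a using g(1) by simp
  moreover have "y = (\<Sum>x\<in>euler_index c n. a x * euler_basis p x)"
    by (rule Rcoef_eqI) (simp add: Rcoef_combination const a y)
  ultimately show thesis by (rule that)
qed

end

end

section \<open>Passage to coefficient lists and conclusion\<close>

lemma combine_map:
  "ring.combine ring_of_type_algebra (map a is) (map f is) = (\<Sum>x\<leftarrow>is. a x * (f x :: 'b::comm_ring_1))"
proof -
  interpret R: ring "ring_of_type_algebra :: 'b ring" by (rule ring_from_type_algebra)
  show ?thesis by (induction "is") simp_all
qed

text \<open>Along a distinct list of indices, a list of scalars is the same as scalars given by a
  function, the form used in the sums.\<close>

lemma list_eq_map_of_distinct:
  assumes "distinct is" "length Ks = length is"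
  obtains a where "Ks = map a is"
proof
  show "Ks = map (the \<circ> map_of (zip is Ks)) is"
    using assms by (intro nth_equalityI) (simp_all add: map_of_zip_nth)
qed

theorem proposition3p9:
  fixes c :: "nat \<Rightarrow> 'k::alg_closed_field" and n p :: nat
  assumes "CHAR('k) = p" and "p > 0" and "c n \<noteq> 0"
  shows "subalgebra (Rconstants p) (euler_solutions c n) ring_of_type_algebra
    \<and> ring.dimension ring_of_type_algebra n (Rconstants p) (euler_solutions c n)
    \<and> finite (euler_index c n)
    \<and> (\<forall>is. distinct is \<longrightarrow> set is = euler_index c n \<longrightarrow>
         ring.independent ring_of_type_algebra (Rconstants p) (map (euler_basis p) is)
       \<and> ring.Span ring_of_type_algebra (Rconstants p) (map (euler_basis p) is)
           = euler_solutions c n)"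
proof -
  \<comment> \<open>A positive characteristic of a domain is prime.\<close>
  interpret prime_char p "TYPE('k)"
    using assms(1,2) prime_CHAR_semidom by unfold_locales auto
  let ?R = "ring_of_type_algebra :: 'k eulring ring"
  let ?C = "Rconstants p :: 'k eulring set"
  interpret R: cring ?R by (rule cring_from_type_algebra)
  note K = Rconstants_subfield
  note lead = assms(3)
  have combine: "R.combine (map a is) (map (euler_basis p) is) = (\<Sum>x\<in>euler_index c n. a x * euler_basis p x)"
    if "distinct is" "set is = euler_index c n" for a "is"
    using that by (simp add: combine_map sum_list_distinct_conv_sum_set)
  have indep: "R.independent ?C (map (euler_basis p) is)"
    if dist: "distinct is" and set: "set is = euler_index c n" for "is"
  proof (rule R.trivial_combine_imp_independent[OF K])
    fix Ks assume Ks: "set Ks \<subseteq> ?C" "R.combine Ks (map (euler_basis p) is) = \<zero>\<^bsub>?R\<^esub>"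
    \<comment> \<open>\<open>combine\<close> accepts lists of different lengths; truncating or
      padding with zeros gives one scalar per basis element.\<close>
    obtain Ks' where take: "set (take (length (map (euler_basis p) is)) Ks) \<subseteq> set Ks'"
      and Ks': "set Ks' \<subseteq> set (take (length (map (euler_basis p) is)) Ks) \<union> {\<zero>\<^bsub>?R\<^esub>}"
        "length Ks' = length (map (euler_basis p) is)" "R.combine Ks' (map (euler_basis p) is) = \<zero>\<^bsub>?R\<^esub>"
      by (rule R.combine_normalize[OF _ _ Ks(2)]) auto
    have "set Ks' \<subseteq> ?C"
      using Ks'(1) Ks(1) set_take_subset[of _ Ks] R.subring_props(2)[OF K] by fastforce
    moreover obtain a where a: "Ks' = map a is"
      using list_eq_map_of_distinct[OF dist] Ks'(2) by auto
    ultimately have "a x \<in> ?C" if "x \<in> euler_index c n" for x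
      using set that by auto
    moreover have "(\<Sum>x\<in>euler_index c n. a x * euler_basis p x) = 0"
      using Ks'(3) combine[OF dist set] by (simp add: a)
    ultimately have "a x = 0" if "x \<in> euler_index c n" for x
      using euler_basis_independent[of c n a x, OF lead] that by blast
    with take show "set (take (length (map (euler_basis p) is)) Ks) \<subseteq> {\<zero>\<^bsub>?R\<^esub>}"
      using set unfolding a by auto
  qed simp
  have span: "R.Span ?C (map (euler_basis p) is) = euler_solutions c n"
    if dist: "distinct is" and set: "set is = euler_index c n" for "is"
  proof -
    have "y \<in> R.Span ?C (map (euler_basis p) is) \<longleftrightarrow> y \<in> euler_solutions c n" for y
    proof
      assume "y \<in> R.Span ?C (map (euler_basis p) is)"
      then obtain Ks where Ks: "set Ks \<subseteq> ?C" "length Ks = length is"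
        "y = R.combine Ks (map (euler_basis p) is)"
        using R.Span_mem_iff_length_version[OF K, of "map (euler_basis p) is"] by auto
      obtain a where a: "Ks = map a is"
        using list_eq_map_of_distinct[OF dist Ks(2)] by blast
      show "y \<in> euler_solutions c n"
        unfolding Ks(3) a combine[OF dist set]
        by (rule combination_in_euler_solutions[of c n, OF lead]) (use Ks(1) a set in auto)
    next
      assume "y \<in> euler_solutions c n"
      then obtain a where a: "\<And>x. a x \<in> ?C" "y = (\<Sum>x\<in>euler_index c n. a x * euler_basis p x)"
        using euler_solutions_combination[of c n, OF lead] by blast
      then have "\<exists>Ks. set Ks \<subseteq> ?C \<and> length Ks = length (map (euler_basis p) is)
          \<and> y = R.combine Ks (map (euler_basis p) is)"
        by (intro exI[of _ "map a is"]) (auto simp: combine[OF dist set])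
      then show "y \<in> R.Span ?C (map (euler_basis p) is)"
        using R.Span_mem_iff_length_version[OF K, of "map (euler_basis p) is"] by (simp del: R.Span.simps)
    qed
    then show ?thesis by blast
  qed
  obtain "is" where "is": "set is = euler_index c n" "distinct is"
    using finite_distinct_list[OF finite_euler_index[of c n, OF lead]] by blast
  \<comment> \<open>The dimension is the number of roots with multiplicity, that is, the degree of
    the indicial polynomial.\<close>
  have "card (euler_index c n) = (\<Sum>\<rho>\<in>local_exponents c n. exponent_mult c n \<rho>)"
    unfolding euler_index_eq[of c n, OF lead] using finite_local_exponents[of c n, OF lead] by simp
  also have "\<dots> = n"
    unfolding local_exponents_def exponent_mult_def
    using sum_order_alg_closed[OF indicial_nonzero[of c n, OF lead]] degree_indicial_poly[of c n, OF lead] by simp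
  finally have "length is = n"
    using "is" by (simp flip: distinct_card)
  then have dim: "R.dimension n ?C (euler_solutions c n)"
    using R.dimension_independent[OF indep[OF "is"(2,1)]] span[OF "is"(2,1)] by simp
  have "subalgebra ?C (R.Span ?C (map (euler_basis p) is)) ?R"
    by (intro subalgebra.intro subalgebra_axioms.intro R.Span_is_add_subgroup[OF K]
        R.Span_smult_closed[OF K]) auto
  then have "subalgebra ?C (euler_solutions c n) ?R"
    by (simp only: span[OF "is"(2,1)])
  then show ?thesis
    using dim finite_euler_index[of c n, OF lead] indep span by blast
qed

end
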